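(* Given any parameter $\ell>1$ and positive integer $n$, there exist a $\frac1n$-separated subset $\{\xi_j\}_{j=1}^{m_n}$ of $\Omega$ with respect to the metric $\rho_\Omega$ and a sequence of polynomials $\{P_j\}_{j=1}^{m_n}\subset\Pi_{c_0n}^{d+1}$ such that for every $\xi\in\Omega$, $$\sum_{j=1}^{m_n}P_j(\xi)=1\quad\text{and}\quad|P_j(\xi)|\le C_1\big(1+n\rho_\Omega(\xi,\xi_j)\big)^{-\ell},\quad j=1,2,\dots,m_n,$$ where the constants $c_0$ and $C_1$ depend only on $d$ and $\ell$.
   Context: Let $d\ge1$ be an integer, $\|\cdot\|$ the Euclidean norm, $\mathrm{dist}(\xi,E)=\inf_{\eta\in E}\|\xi-\eta\|$. A bounded domain $\Omega_0\subset\mathbb{R}^{d+1}$ is $C^2$ if there exist $\delta>0$, $M>0$ and a finite cover of its boundary $\Gamma$ by connected open sets $U_1,\dots,U_J$ such that (i) for every $x\in\Omega_0$ with $\mathrm{dist}(x,\Gamma)<\delta$ there is $j$ with $x\in U_j$ and $\mathrm{dist}(x,\partial U_j)>\delta$; (ii) for each $j$ there is a Cartesian coordinate system $(\xi_{j,1},\dots,\xi_{j,d+1})$ in $U_j$ in which $\Omega_0\cap U_j$ is represented by $\xi_{j,d+1}\le f_j(\xi_{j,1},\dots,\xi_{j,d})$ with $f_j:\mathbb{R}^d\to\mathbb{R}$ of class $C^2$ and $\max_{i,k}\|\partial_i\partial_kf_j\|_\infty\le M$. $\Omega$ is the closure of an open, connected, bounded $C^2$-domain in $\mathbb{R}^{d+1}$,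 with boundary $\Gamma=\partial\Omega$. The metric on $\Omega$ is $\rho_\Omega(\xi,\eta)=\|\xi-\eta\|+\big|\sqrt{\mathrm{dist}(\xi,\Gamma)}-\sqrt{\mathrm{dist}(\eta,\Gamma)}\big|$. A set $\Lambda$ in a metric space $(X,\rho)$ is $\varepsilon$-separated, for some $\varepsilon>0$, if $\rho(\omega,\omega')\ge\varepsilon$ for any two distinct $\omega,\omega'\in\Lambda$. $\Pi_s^{d+1}$ is the space of real polynomials on $\mathbb{R}^{d+1}$ of total degree at most $s$.
   Formalization: The constants c_0 and C_1 are allowed to depend on the fixed domain Ω as well as on d and ℓ (not on n, the points or the polynomials); constants depending only on d and ℓ, uniform over all C^2 domains, do not exist (n=1, long tubes or large balls). *)

theory Defs
  imports "HOL-Analysis.Analysis"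
begin

text \<open>
  Euclidean space of dimension d + 1 is the type \<open>(real ^ 'd) \<times> real\<close> with \<open>d = CARD('d)\<close>
  (so d is an arbitrary integer that is at least 1): the norm of the product type is the Euclidean
  norm, and the second component is the last coordinate.
\<close>

text \<open>
  The matrix \<open>H x\<close> is the Jacobian of the gradient \<open>g\<close> at \<open>x\<close>, so its entries are the second
  partial derivatives of \<open>f\<close>.
\<close>

definition C2_hessian_bounded :: "real \<Rightarrow> (real ^ 'd \<Rightarrow> real) \<Rightarrow> bool" where
  "C2_hessian_bounded M f \<longleftrightarrow>
     (\<exists>(g :: real ^ 'd \<Rightarrow> real ^ 'd) (H :: real ^ 'd \<Rightarrow> real ^ 'd ^ 'd).
        (\<forall>x. (f has_derivative (\<lambda>h. g x \<bullet> h)) (at x)) \<and>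
        (\<forall>x. (g has_derivative (\<lambda>h. H x *v h)) (at x)) \<and>
        continuous_on UNIV H \<and>
        (\<forall>i k x. \<bar>H x $ i $ k\<bar> \<le> M))"

text \<open>
  A Cartesian coordinate system is \<open>x \<mapsto> A (x - a)\<close> with origin \<open>a\<close> and \<open>A\<close> orthogonal.
  The domain is open, so it is the strict subgraph of \<open>f\<close> inside \<open>U j\<close>, while its closure is
  represented there by the non-strict inequality.  The non-strict inequality for the open set itself
  would be unsatisfiable: the subset of the connected set \<open>U j\<close> that it describes would be both open
  and closed in \<open>U j\<close>, and \<open>U j\<close> could not meet the boundary.
\<close>

definition C2_domain :: "((real ^ 'd) \<times> real) set \<Rightarrow> bool" where
  "C2_domain D \<longleftrightarrow>
     open D \<and> connected D \<and> bounded D \<and> D \<noteq> {} \<and>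
     (\<exists>\<delta>>0. \<exists>M>0. \<exists>(J :: nat) (U :: nat \<Rightarrow> ((real ^ 'd) \<times> real) set).
        (\<forall>j\<in>{1..J}. open (U j) \<and> connected (U j)) \<and>
        frontier D \<subseteq> (\<Union>j\<in>{1..J}. U j) \<and>
        (\<forall>x\<in>D. infdist x (frontier D) < \<delta> \<longrightarrow>
           (\<exists>j\<in>{1..J}. x \<in> U j \<and> infdist x (frontier (U j)) > \<delta>)) \<and>
        (\<forall>j\<in>{1..J}. \<exists>(a :: (real ^ 'd) \<times> real)
             (A :: (real ^ 'd) \<times> real \<Rightarrow> (real ^ 'd) \<times> real) (f :: real ^ 'd \<Rightarrow> real).
           orthogonal_transformation A \<and> C2_hessian_bounded M f \<and>
           D \<inter> U j = {x \<in> U j. snd (A (x - a)) < f (fst (A (x - a)))}))"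

definition rho :: "'a :: euclidean_space set \<Rightarrow> 'a \<Rightarrow> 'a \<Rightarrow> real" where
  "rho \<Omega> \<xi> \<eta> =
     norm (\<xi> - \<eta>) + \<bar>sqrt (infdist \<xi> (frontier \<Omega>)) - sqrt (infdist \<eta> (frontier \<Omega>))\<bar>"

definition separated :: "('a \<Rightarrow> 'a \<Rightarrow> real) \<Rightarrow> real \<Rightarrow> 'a set \<Rightarrow> bool" where
  "separated \<rho> \<epsilon> \<Lambda> \<longleftrightarrow> (\<forall>\<omega>\<in>\<Lambda>. \<forall>\<omega>'\<in>\<Lambda>. \<omega> \<noteq> \<omega>' \<longrightarrow> \<rho> \<omega> \<omega>' \<ge> \<epsilon>)"

text \<open>Real polynomial functions of total degree at most \<open>s\<close>; \<open>\<alpha>\<close> runs over multi-indices.\<close>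

definition poly_space :: "nat \<Rightarrow> ('a :: euclidean_space \<Rightarrow> real) set" where
  "poly_space s =
     {p. \<exists>a :: ('a \<Rightarrow> nat) \<Rightarrow> real. \<forall>x.
           p x = (\<Sum>\<alpha> \<in> {\<alpha> \<in> Basis \<rightarrow>\<^sub>E UNIV. (\<Sum>b\<in>Basis. \<alpha> b) \<le> s}.
                    a \<alpha> * (\<Prod>b\<in>Basis. (x \<bullet> b) ^ \<alpha> b))}"

text \<open>
  The index set of the sum is finite, so the sum is not the degenerate one over an infinite set.
\<close>

lemma finite_multi_indices:
  "finite {\<alpha> \<in> (Basis :: 'a :: euclidean_space set) \<rightarrow>\<^sub>E (UNIV :: nat set). (\<Sum>b\<in>Basis. \<alpha> b) \<le> s}"
proof (rule finite_subset)
  show "{\<alpha> \<in> (Basis :: 'a set) \<rightarrow>\<^sub>E (UNIV :: nat set). (\<Sum>b\<in>Basis. \<alpha> b) \<le> s}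
          \<subseteq> Basis \<rightarrow>\<^sub>E {..s}"
  proof (intro subsetI PiE_I)
    fix \<alpha> :: "'a \<Rightarrow> nat" and b :: 'a
    assume \<alpha>: "\<alpha> \<in> {\<alpha> \<in> Basis \<rightarrow>\<^sub>E UNIV. (\<Sum>b\<in>Basis. \<alpha> b) \<le> s}"
      and b: "b \<in> Basis"
    have "\<alpha> b \<le> (\<Sum>b\<in>Basis. \<alpha> b)"
      by (rule member_le_sum[OF b]) (rule zero_le, rule finite_Basis)
    also have "\<dots> \<le> s"
      using \<alpha> by blast
    finally show "\<alpha> b \<in> {..s}"
      by (rule atMost_iff[THEN iffD2])
  next
    fix \<alpha> :: "'a \<Rightarrow> nat" and b :: 'a
    assume "\<alpha> \<in> {\<alpha> \<in> Basis \<rightarrow>\<^sub>E UNIV. (\<Sum>b\<in>Basis. \<alpha> b) \<le> s}"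
      and "b \<notin> Basis"
    then show "\<alpha> b = undefined"
      by (blast dest: PiE_arb)
  qed
  show "finite ((Basis :: 'a set) \<rightarrow>\<^sub>E {..s})"
    by (rule finite_PiE[OF finite_Basis finite_atMost])
qed

end

theory Submission
  imports Defs "HOL-Computational_Algebra.Polynomial"
begin

text \<open>
  Translates of a power of the Fejer kernel by the points \<open>2 * pi * k / N\<close> sum to a constant;
  symmetrized in the angle they are nonnegative polynomials in the cosine that form a partition of
  unity localized at scale \<open>1 / n\<close>.  Taking even parts gives polynomials in \<open>u\<^sup>2\<close> that are localized
  in \<open>u\<close>.

  A tensor product of such partitions resolves the Euclidean part of the metric.  For each of its
  centres \<open>y\<close>, let \<open>ball w r\<close> be an exterior ball touching the boundary at the point closest
  to \<open>y\<close>.  The interior and exterior tangent balls show that \<open>sqrt ((norm (x - w))\<^sup>2 - r\<^sup>2)\<close>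
  controls the square root of the distance to the boundary up to an error \<open>O(norm (x - y))\<close>.  This
  error is absorbed by the Euclidean localization, so multiplying by the one-variable partition in
  the quadratic polynomial \<open>(norm (x - w))\<^sup>2 - r\<^sup>2\<close> resolves the other part of the metric.

  All pieces are nonnegative, so localization is expressed by bounded weighted sums
  \<open>\<Sum>i. Q i x * (1 + n * rho x (\<eta> i)) ^ k\<close>.  These survive adding up all pieces whose
  centres are attached to the same point of a maximal separated set; no counting of centres is needed.
\<close>

section \<open>Localized partitions of unity in one variable\<close>

definition cosine_poly :: "nat \<Rightarrow> (real \<Rightarrow> real) \<Rightarrow> bool" where
  "cosine_poly s f \<longleftrightarrow> (\<exists>a. \<forall>\<theta>. f \<theta> = (\<Sum>j\<le>s. a j * cos (real j * \<theta>)))"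

lemma cosine_poly_cos: "j \<le> s \<Longrightarrow> cosine_poly s (\<lambda>\<theta>. cos (real j * \<theta>))"
  unfolding cosine_poly_def
  by (rule exI[of _ "\<lambda>i. if i = j then 1 else 0"]) (simp add: if_distrib[of "\<lambda>c. c * _"] cong: if_cong)

lemma cosine_poly_add:
  assumes "cosine_poly s f" "cosine_poly s g"
  shows "cosine_poly s (\<lambda>\<theta>. f \<theta> + g \<theta>)"
proof -
  obtain a b where "\<forall>\<theta>. f \<theta> = (\<Sum>j\<le>s. a j * cos (real j * \<theta>))"
    "\<forall>\<theta>. g \<theta> = (\<Sum>j\<le>s. b j * cos (real j * \<theta>))"
    using assms unfolding cosine_poly_def by blast
  then show ?thesis
    unfolding cosine_poly_def
    by (intro exI[of _ "\<lambda>j. a j + b j"]) (simp add: algebra_simps sum.distrib)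
qed

lemma cosine_poly_cmult:
  assumes "cosine_poly s f"
  shows "cosine_poly s (\<lambda>\<theta>. c * f \<theta>)"
proof -
  obtain a where "\<forall>\<theta>. f \<theta> = (\<Sum>j\<le>s. a j * cos (real j * \<theta>))"
    using assms unfolding cosine_poly_def by blast
  then show ?thesis
    unfolding cosine_poly_def
    by (intro exI[of _ "\<lambda>j. c * a j"]) (simp add: sum_distrib_left mult.assoc)
qed

lemma cosine_poly_sum:
  assumes "\<And>i. i \<in> I \<Longrightarrow> cosine_poly s (f i)"
  shows "cosine_poly s (\<lambda>\<theta>. \<Sum>i\<in>I. f i \<theta>)"
proof -
  have "cosine_poly s (\<lambda>_. 0)"
    unfolding cosine_poly_def by (rule exI[of _ "\<lambda>_. 0"]) simp
  then show ?thesis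
    using assms by (induction I rule: infinite_finite_induct) (auto intro: cosine_poly_add)
qed

text \<open>The term \<open>max i j - min i j\<close> is the absolute difference as a natural number
  without truncation, so the frequency can again serve as an index of a cosine polynomial.\<close>

lemma cos_diff_nat:
  fixes i j :: nat
  shows "cos (real i * \<theta> - real j * \<theta>) = cos (real (max i j - min i j) * \<theta>)"
proof (cases "j \<le> i")
  case True
  then show ?thesis by (simp add: max_def min_def of_nat_diff algebra_simps)
next
  case False
  then have "cos (real i * \<theta> - real j * \<theta>) = cos (- (real (j - i) * \<theta>))"
    by (simp add: of_nat_diff algebra_simps)
  then show ?thesis using False by (simp add: max_def min_def)
qed

text \<open>Product-to-sum: two cosines of frequencies \<open>i\<close> and \<open>j\<close>
  multiply to half the sum of those of frequencies |i - j| and i + j, both at most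
  \<open>s + t\<close>.\<close>

lemma cosine_poly_mult:
  assumes "cosine_poly s f" "cosine_poly t g"
  shows "cosine_poly (s + t) (\<lambda>\<theta>. f \<theta> * g \<theta>)"
proof -
  obtain a b where f: "\<And>\<theta>. f \<theta> = (\<Sum>j\<le>s. a j * cos (real j * \<theta>))"
    and g: "\<And>\<theta>. g \<theta> = (\<Sum>j\<le>t. b j * cos (real j * \<theta>))"
    using assms unfolding cosine_poly_def by blast
  have fg: "f \<theta> * g \<theta> = (\<Sum>i\<le>s. \<Sum>j\<le>t. (a i * b j / 2) *
      (cos (real (max i j - min i j) * \<theta>) + cos (real (i + j) * \<theta>)))" for \<theta>
    unfolding f g sum_product
    by (intro sum.cong refl)
      (simp add: cos_diff_nat[symmetric] cos_diff cos_add distrib_right add_divide_distrib del: of_nat_diff)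
  show ?thesis
    unfolding fg
    by (intro cosine_poly_sum cosine_poly_cmult cosine_poly_add cosine_poly_cos) auto
qed

lemma cosine_poly_power: "cosine_poly s f \<Longrightarrow> cosine_poly (m * s) (\<lambda>\<theta>. f \<theta> ^ m)"
proof (induction m)
  case 0
  show ?case using cosine_poly_cos[of 0 0] by simp
next
  case (Suc m)
  then show ?case using cosine_poly_mult[of s f "m * s" "\<lambda>\<theta>. f \<theta> ^ m"] by simp
qed

text \<open>The terms are real parts of a geometric progression whose ratio is an
  \<open>N\<close>-th root of unity; the ratio differs from 1 because \<open>N\<close> does not
  divide \<open>j\<close>.\<close>

lemma sum_cos_equidistant:
  fixes j N :: nat
  assumes "0 < j" "j < N"
  shows "(\<Sum>k<N. cos (real j * (\<theta> + 2 * pi * real k / real N))) = 0"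
proof -
  define z where "z = cis (2 * pi * real j / real N)"
  have "z \<noteq> 1"
  proof
    assume "z = 1"
    then have "cos (2 * pi * real j / real N) = 1"
      unfolding z_def by (metis Re_complex_of_real cis.sel(1) of_real_1)
    then obtain i :: int where "2 * pi * real j / real N = of_int i * 2 * pi"
      using cos_one_2pi_int by (metis mult.assoc mult.commute)
    then have "real j = of_int i * real N"
      using assms by (simp add: field_simps)
    then have "int j = i * int N"
      by (metis of_int_eq_iff of_int_mult of_int_of_nat_eq)
    then have "int N dvd int j" by simp
    then show False using assms by (simp add: nat_dvd_not_less)
  qed
  moreover have "z ^ N = 1"
  proof -
    have "z ^ N = cis (2 * pi * real j)"
      unfolding z_def Complex.DeMoivre using assms by (simp add: field_simps)
    then show ?thesis by (simp add: cis_multiple_2pi)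
  qed
  ultimately have "(\<Sum>k<N. z ^ k) = 0"
    by (simp add: geometric_sum)
  then have "(\<Sum>k<N. cis (real j * \<theta>) * z ^ k) = 0"
    by (metis sum_distrib_left mult_zero_right)
  moreover have "cis (real j * \<theta>) * z ^ k = cis (real j * (\<theta> + 2 * pi * real k / real N))" for k
    by (simp add: z_def Complex.DeMoivre cis_mult algebra_simps)
  ultimately have "Re (\<Sum>k<N. cis (real j * (\<theta> + 2 * pi * real k / real N))) = 0"
    by simp
  then show ?thesis by simp
qed

text \<open>Frequencies strictly between 0 and \<open>N\<close> cancel over the \<open>N\<close>
  points, and \<open>s < N\<close> leaves no others except the constant term.\<close>

lemma cosine_poly_sum_equidistant:
  assumes "cosine_poly s f" "s < N"
  obtains c where "\<And>\<theta>. (\<Sum>k<N. f (\<theta> + 2 * pi * real k / real N)) = c"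
proof -
  obtain a where f: "\<And>\<theta>. f \<theta> = (\<Sum>j\<le>s. a j * cos (real j * \<theta>))"
    using assms unfolding cosine_poly_def by blast
  have "(\<Sum>k<N. f (\<theta> + 2 * pi * real k / real N)) = a 0 * real N" for \<theta>
  proof -
    have "(\<Sum>k<N. f (\<theta> + 2 * pi * real k / real N))
        = (\<Sum>j\<le>s. a j * (\<Sum>k<N. cos (real j * (\<theta> + 2 * pi * real k / real N))))"
      unfolding f by (subst sum.swap) (simp add: sum_distrib_left)
    also have "\<dots> = (\<Sum>j\<le>s. if j = 0 then a 0 * real N else 0)"
      using assms(2) by (intro sum.cong refl) (auto simp: sum_cos_equidistant)
    finally show ?thesis by simp
  qed
  then show ?thesis using that by blast
qed

lemma cosine_poly_even:
  assumes "cosine_poly s f"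
  shows "f (- \<theta>) = f \<theta>"
  using assms unfolding cosine_poly_def by auto

section \<open>Passage from cosine polynomials to algebraic polynomials\<close>

text \<open>These are the Chebyshev polynomials, built by the recurrence T(j) = 2 x T(j-1) - T(j-2);
  \<open>pCons 0 (smult 2 q)\<close> is 2 x q.\<close>

lemma chebyshev_poly:
  "\<exists>p :: real poly. degree p \<le> j \<and> (\<forall>\<theta>. poly p (cos \<theta>) = cos (real j * \<theta>))"
proof (induction j rule: less_induct)
  case (less j)
  consider "j = 0" | "j = 1" | i where "j = Suc (Suc i)"
    by (metis One_nat_def not0_implies_Suc)
  then show ?case
  proof cases
    case 1
    then show ?thesis by (intro exI[of _ 1]) simp
  next
    case 2
    then show ?thesis by (intro exI[of _ "[:0, 1:]"]) simp
  next
    case (3 i)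
    obtain p q :: "real poly" where
      p: "degree p \<le> i" "\<And>\<theta>. poly p (cos \<theta>) = cos (real i * \<theta>)" and
      q: "degree q \<le> Suc i" "\<And>\<theta>. poly q (cos \<theta>) = cos (real (Suc i) * \<theta>)"
      using less[of i] less[of "Suc i"] 3 by auto
    have "degree (pCons 0 (smult 2 q) - p) \<le> j"
      using p(1) q(1) 3 by (intro degree_diff_le) (auto simp: degree_pCons_eq_if)
    moreover have "poly (pCons 0 (smult 2 q) - p) (cos \<theta>) = cos (real j * \<theta>)" for \<theta>
    proof -
      have "cos (real j * \<theta>) = cos (real (Suc i) * \<theta> + \<theta>)"
        "cos (real i * \<theta>) = cos (real (Suc i) * \<theta> - \<theta>)"
        using 3 by (auto simp: algebra_simps)
      then show ?thesis
        by (simp add: p(2) q(2) cos_add cos_diff del: of_nat_Suc)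
    qed
    ultimately show ?thesis by blast
  qed
qed

text \<open>A translate of an even function is no longer even; averaging the translates by \<phi>
  and -\<phi> cancels the sine terms and leaves cos(j \<phi>) cos(j \<theta>), a polynomial in cos
  \<theta>.\<close>

lemma cosine_poly_symmetrize:
  assumes "cosine_poly s f"
  shows "\<exists>p :: real poly. degree p \<le> s \<and>
    (\<forall>\<theta>. poly p (cos \<theta>) = (f (\<theta> + \<phi>) + f (\<theta> - \<phi>)) / 2)"
proof -
  obtain a where f: "\<And>\<theta>. f \<theta> = (\<Sum>j\<le>s. a j * cos (real j * \<theta>))"
    using assms unfolding cosine_poly_def by blast
  obtain T :: "nat \<Rightarrow> real poly" where T: "\<And>j. degree (T j) \<le> j"
    "\<And>j \<theta>. poly (T j) (cos \<theta>) = cos (real j * \<theta>)"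
    using chebyshev_poly by metis
  let ?p = "\<Sum>j\<le>s. smult (a j * cos (real j * \<phi>)) (T j)"
  have "degree ?p \<le> s"
    by (intro degree_sum_le) (auto intro: order_trans[OF degree_smult_le] order_trans[OF T(1)])
  moreover have "poly ?p (cos \<theta>) = (f (\<theta> + \<phi>) + f (\<theta> - \<phi>)) / 2" for \<theta>
    unfolding f
    by (simp add: poly_sum T(2) sum.distrib[symmetric] sum_divide_distrib distrib_left
        right_diff_distrib cos_add cos_diff mult.assoc)
  ultimately show ?thesis by blast
qed

section \<open>The Fejer kernel and the decay of its powers\<close>

text \<open>This is \<open>n\<close> times the classical Fejer kernel, that is (sin(n \<theta>/2) /
  sin(\<theta>/2)) squared wherever the denominator is nonzero. The squared modulus makes it
  nonnegative and avoids the quotient.\<close>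

definition fejer :: "nat \<Rightarrow> real \<Rightarrow> real" where
  "fejer n \<theta> = (cmod (\<Sum>j<n. cis (real j * \<theta>)))\<^sup>2"

lemma fejer_eq: "fejer n \<theta> = (\<Sum>i<n. \<Sum>j<n. cos (real (max i j - min i j) * \<theta>))"
  unfolding fejer_def cmod_power2
  by (simp add: power2_eq_square sum_product sum.distrib[symmetric] cos_diff_nat[symmetric] cos_diff del: of_nat_diff)

lemma cosine_poly_fejer: "cosine_poly (n - 1) (fejer n)"
  unfolding fejer_eq[abs_def] by (intro cosine_poly_sum cosine_poly_cos) auto

text \<open>All frequencies are below \<open>n\<close>, so only the \<open>n\<close> diagonal terms
  of the double sum survive. The exact value is what later makes the moment bound independent of
  \<open>n\<close>.\<close>

lemma sum_fejer_equidistant: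
  assumes "n \<le> N"
  shows "(\<Sum>k<N. fejer n (\<theta> + 2 * pi * real k / real N)) = real n * real N"
proof -
  have "(\<Sum>k<N. fejer n (\<theta> + 2 * pi * real k / real N)) = (\<Sum>i<n. \<Sum>j<n.
      \<Sum>k<N. cos (real (max i j - min i j) * (\<theta> + 2 * pi * real k / real N)))"
    unfolding fejer_eq
    by (subst sum.swap, rule sum.cong[OF refl], rule sum.swap)
  also have "\<dots> = (\<Sum>i<n. \<Sum>j<n. if i = j then real N else 0)"
  proof (intro sum.cong refl)
    fix i j assume "i \<in> {..<n}" "j \<in> {..<n}"
    then show "(\<Sum>k<N. cos (real (max i j - min i j) * (\<theta> + 2 * pi * real k / real N)))
        = (if i = j then real N else 0)"
      using assms by (cases "i = j") (auto intro!: sum_cos_equidistant simp del: of_nat_diff)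
  qed
  finally show ?thesis by simp
qed

lemma fejer_0: "fejer n 0 = (real n)\<^sup>2"
  by (simp add: fejer_def)

lemma fejer_nonneg: "0 \<le> fejer n \<theta>"
  by (simp add: fejer_def)

lemma fejer_le: "fejer n \<theta> \<le> (real n)\<^sup>2"
proof -
  have "cmod (\<Sum>j<n. cis (real j * \<theta>)) \<le> (\<Sum>j<n. 1)"
    by (rule order_trans[OF norm_sum]) simp
  then show ?thesis unfolding fejer_def by (intro power_mono) auto
qed

text \<open>The geometric sum times 1 - \<open>cis \<theta>\<close> has modulus at most 2, while 1 -
  \<open>cis \<theta>\<close> has modulus 2 |sin(\<theta>/2)|.\<close>

lemma fejer_sin_le: "fejer n \<theta> * (sin (\<theta> / 2))\<^sup>2 \<le> 1"
proof -
  let ?S = "\<Sum>j<n. cis (real j * \<theta>)"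
  have S: "?S = (\<Sum>j<n. cis \<theta> ^ j)" by (rule sum.cong) (simp_all only: Complex.DeMoivre)
  have "(1 - cis \<theta>) * ?S = 1 - cis \<theta> ^ n"
    unfolding S by (rule one_diff_power_eq[symmetric])
  then have "cmod (1 - cis \<theta>) * cmod ?S = cmod (1 - cis \<theta> ^ n)"
    by (metis norm_mult)
  also have "\<dots> \<le> 2"
    by (rule order_trans[OF norm_triangle_ineq4]) (simp add: norm_power)
  finally have "(cmod (1 - cis \<theta>) * cmod ?S)\<^sup>2 \<le> 2\<^sup>2"
    by (intro power_mono) auto
  moreover have "(cmod (1 - cis \<theta>))\<^sup>2 = 4 * (sin (\<theta> / 2))\<^sup>2"
  proof -
    have "(cmod (1 - cis \<theta>))\<^sup>2 = (1 - cos \<theta>)\<^sup>2 + (sin \<theta>)\<^sup>2"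
      by (simp add: cmod_power2)
    also have "\<dots> = 2 - 2 * cos \<theta>"
      using sin_cos_squared_add[of \<theta>] by (simp add: power2_eq_square algebra_simps)
    also have "\<dots> = 4 * (sin (\<theta> / 2))\<^sup>2"
      using cos_double_sin[of "\<theta> / 2"] by simp
    finally show ?thesis .
  qed
  ultimately show ?thesis
    by (simp add: fejer_def power_mult_distrib algebra_simps)
qed

lemma fejer_decay:
  assumes "\<bar>t\<bar> \<le> 2 * \<bar>sin (\<theta> / 2)\<bar>"
  shows "fejer n \<theta> * (1 + real n * \<bar>t\<bar>)\<^sup>2 \<le> 9 * (real n)\<^sup>2"
\<comment> \<open>Splitting at 2 gives the constant 9 in both cases: below it the weight is at most
  3 squared; above it 1 + n|t| is at most 3/2 n|t|, and the sine bound supplies another factor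
  4.\<close>
proof (cases "real n * \<bar>t\<bar> \<le> 2")
  case True
  then have "(1 + real n * \<bar>t\<bar>)\<^sup>2 \<le> 3\<^sup>2" by (intro power_mono) auto
  from mult_mono[OF fejer_le[of n \<theta>] this] show ?thesis by simp
next
  case False
  then have "(1 + real n * \<bar>t\<bar>)\<^sup>2 \<le> (3 / 2 * (real n * \<bar>t\<bar>))\<^sup>2"
    by (intro power_mono) linarith+
  also have "\<dots> \<le> (3 / 2 * (real n * (2 * \<bar>sin (\<theta> / 2)\<bar>)))\<^sup>2"
    using assms by (intro power_mono mult_left_mono) auto
  also have "\<dots> = 9 * (real n)\<^sup>2 * (sin (\<theta> / 2))\<^sup>2"
    by (simp add: power_mult_distrib)
  finally have "fejer n \<theta> * (1 + real n * \<bar>t\<bar>)\<^sup>2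
      \<le> fejer n \<theta> * (9 * (real n)\<^sup>2 * (sin (\<theta> / 2))\<^sup>2)"
    by (intro mult_left_mono fejer_nonneg)
  also have "\<dots> = 9 * (real n)\<^sup>2 * (fejer n \<theta> * (sin (\<theta> / 2))\<^sup>2)" by simp
  also have "\<dots> \<le> 9 * (real n)\<^sup>2 * 1"
    by (intro mult_left_mono fejer_sin_le) auto
  finally show ?thesis by simp
qed

text \<open>Of the \<open>Suc K\<close> factors, \<open>K\<close> absorb the weight; the remaining
  one is kept so that the translates can still be summed exactly.\<close>

lemma fejer_power_decay:
  assumes "\<bar>t\<bar> \<le> 2 * \<bar>sin (\<theta> / 2)\<bar>"
  shows "fejer n \<theta> ^ Suc K * (1 + real n * \<bar>t\<bar>) ^ (2 * K) \<le> fejer n \<theta> * (9 * (real n)\<^sup>2) ^ K"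
proof -
  have "(fejer n \<theta> * (1 + real n * \<bar>t\<bar>)\<^sup>2) ^ K \<le> (9 * (real n)\<^sup>2) ^ K"
    using fejer_decay[OF assms] by (intro power_mono) (auto simp: fejer_nonneg)
  then have "fejer n \<theta> * (fejer n \<theta> * (1 + real n * \<bar>t\<bar>)\<^sup>2) ^ K \<le> fejer n \<theta> * (9 * (real n)\<^sup>2) ^ K"
    by (intro mult_left_mono fejer_nonneg)
  then show ?thesis
    by (simp add: power_mult_distrib power_mult mult.assoc)
qed

section \<open>One-variable partitions of unity with bounded moments\<close>

text \<open>The pieces are symmetrized translates of the power \<open>Suc K\<close> of the Fejer
  kernel, divided by their constant sum, with the cosines of the translation angles as centres. The
  last clause bounds all weights at once, uniformly in \<open>n\<close>.\<close>

lemma localized_partition_cos: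
  fixes n K :: nat
  assumes "n \<ge> 1"
  obtains N :: nat and t :: "nat \<Rightarrow> real" and p :: "nat \<Rightarrow> real poly" where
    "\<And>k. degree (p k) \<le> Suc K * n"
    "\<And>k x. \<bar>x\<bar> \<le> 1 \<Longrightarrow> 0 \<le> poly (p k) x"
    "\<And>x. \<bar>x\<bar> \<le> 1 \<Longrightarrow> (\<Sum>k<N. poly (p k) x) = 1"
    "\<And>x. \<bar>x\<bar> \<le> 1 \<Longrightarrow>
       (\<Sum>k<N. poly (p k) x * (1 + real n * \<bar>x - t k\<bar>) ^ (2 * K)) \<le> 9 ^ K * Suc K"
proof -
  define J where "J \<theta> = fejer n \<theta> ^ Suc K" for \<theta>
  \<comment> \<open>This exceeds the degree \<open>Suc K * (n - 1)\<close>, as constancy of the sum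
    requires, and is proportional to \<open>n\<close>, as the moment bound requires.\<close>
  define N where "N = Suc K * n"
  define \<phi> where "\<phi> k = 2 * pi * real k / real N" for k
  have J_poly: "cosine_poly (Suc K * (n - 1)) J"
    unfolding J_def[abs_def] by (intro cosine_poly_power cosine_poly_fejer)
  have lt: "Suc K * (n - 1) < N" using assms unfolding N_def by (intro mult_strict_left_mono) auto
  obtain c where c_plus: "\<And>\<theta>. (\<Sum>k<N. J (\<theta> + \<phi> k)) = c"
    using cosine_poly_sum_equidistant[OF J_poly lt] unfolding \<phi>_def by blast
  have c_minus: "(\<Sum>k<N. J (\<theta> - \<phi> k)) = c" for \<theta>
    using c_plus[of "- \<theta>"] cosine_poly_even[OF J_poly, of "\<theta> - _"] by simp
  have f_plus: "(\<Sum>k<N. fejer n (\<theta> + \<phi> k)) = real n * real N" for \<theta>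
    unfolding \<phi>_def by (rule sum_fejer_equidistant) (simp add: N_def)
  have f_minus: "(\<Sum>k<N. fejer n (\<theta> - \<phi> k)) = real n * real N" for \<theta>
    using f_plus[of "- \<theta>"] cosine_poly_even[OF cosine_poly_fejer, of n "\<theta> - _"] by simp
  have J_nonneg: "0 \<le> J \<theta>" for \<theta> by (simp add: J_def fejer_nonneg)
  have N: "0 < N" using assms by (simp add: N_def)
  \<comment> \<open>The constant \<open>c\<close> is evaluated at angle 0, where the untranslated
    kernel alone contributes its peak value and no other term is negative.\<close>
  have c_ge: "(real n)\<^sup>2 ^ Suc K \<le> c"
  proof -
    have "J (0 + \<phi> 0) \<le> (\<Sum>k<N. J (0 + \<phi> k))"
      using N by (intro member_le_sum) (auto simp: J_nonneg)
    then show ?thesis unfolding c_plus by (simp add: \<phi>_def J_def fejer_0)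
  qed
  have c_pos: "0 < c"
    using assms by (intro less_le_trans[OF _ c_ge]) simp
  obtain q :: "nat \<Rightarrow> real poly" where q: "\<And>k. degree (q k) \<le> Suc K * (n - 1)"
    "\<And>k \<theta>. poly (q k) (cos \<theta>) = (J (\<theta> + \<phi> k) + J (\<theta> - \<phi> k)) / 2"
  proof -
    have "\<forall>k. \<exists>q :: real poly. degree q \<le> Suc K * (n - 1) \<and>
        (\<forall>\<theta>. poly q (cos \<theta>) = (J (\<theta> + \<phi> k) + J (\<theta> - \<phi> k)) / 2)"
      by (intro allI cosine_poly_symmetrize[OF J_poly])
    from choice[OF this] show ?thesis using that by blast
  qed
  define p where "p k = smult (1 / c) (q k)" for k
  have p: "poly (p k) (cos \<theta>) = (J (\<theta> + \<phi> k) + J (\<theta> - \<phi> k)) / (2 * c)" for k \<theta>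
    by (simp add: p_def q)
  show thesis
  proof
    show "degree (p k) \<le> Suc K * n" for k
      unfolding p_def using q(1)[of k] lt N_def
      by (intro order_trans[OF degree_smult_le]) linarith
  next
    fix x :: real and k assume "\<bar>x\<bar> \<le> 1"
    then obtain \<theta> where x: "x = cos \<theta>" by (metis cos_arccos_abs)
    show "0 \<le> poly (p k) x" unfolding x p using c_pos J_nonneg by simp
  next
    fix x :: real assume "\<bar>x\<bar> \<le> 1"
    then obtain \<theta> where x: "x = cos \<theta>" by (metis cos_arccos_abs)
    show "(\<Sum>k<N. poly (p k) x) = 1"
      unfolding x p using c_pos
      by (simp add: sum_divide_distrib[symmetric] sum.distrib c_plus c_minus)
  next
    fix x :: real assume "\<bar>x\<bar> \<le> 1"
    then obtain \<theta> where x: "x = cos \<theta>" by (metis cos_arccos_abs)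
    \<comment> \<open>The difference of cosines is twice a product of two sines; dropping either
      sine gives the decay hypothesis for the corresponding one of the two translates.\<close>
    have dist: "\<bar>x - cos (\<phi> k)\<bar> \<le> 2 * \<bar>sin ((\<theta> + \<phi> k) / 2)\<bar>"
      "\<bar>x - cos (\<phi> k)\<bar> \<le> 2 * \<bar>sin ((\<theta> - \<phi> k) / 2)\<bar>" for k
    proof -
      have "\<bar>x - cos (\<phi> k)\<bar> = 2 * \<bar>sin ((\<theta> + \<phi> k) / 2)\<bar> * \<bar>sin ((\<theta> - \<phi> k) / 2)\<bar>"
        unfolding x cos_diff_cos
        by (simp add: abs_mult) (metis abs_minus_cancel minus_diff_eq minus_divide_left sin_minus)
      moreover have "\<bar>sin ((\<theta> + \<phi> k) / 2)\<bar> \<le> 1" "\<bar>sin ((\<theta> - \<phi> k) / 2)\<bar> \<le> 1" by auto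
      ultimately show "\<bar>x - cos (\<phi> k)\<bar> \<le> 2 * \<bar>sin ((\<theta> + \<phi> k) / 2)\<bar>"
        "\<bar>x - cos (\<phi> k)\<bar> \<le> 2 * \<bar>sin ((\<theta> - \<phi> k) / 2)\<bar>"
        by (simp_all add: mult_left_le mult_left_le_one_le)
    qed
    have "(\<Sum>k<N. poly (p k) x * (1 + real n * \<bar>x - cos (\<phi> k)\<bar>) ^ (2 * K))
        \<le> (\<Sum>k<N. (fejer n (\<theta> + \<phi> k) + fejer n (\<theta> - \<phi> k)) * (9 * (real n)\<^sup>2) ^ K / (2 * c))"
    proof (intro sum_mono)
      fix k
      have "J (\<theta> + \<phi> k) * (1 + real n * \<bar>x - cos (\<phi> k)\<bar>) ^ (2 * K)
          + J (\<theta> - \<phi> k) * (1 + real n * \<bar>x - cos (\<phi> k)\<bar>) ^ (2 * K)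
          \<le> fejer n (\<theta> + \<phi> k) * (9 * (real n)\<^sup>2) ^ K + fejer n (\<theta> - \<phi> k) * (9 * (real n)\<^sup>2) ^ K"
        unfolding J_def by (intro add_mono fejer_power_decay dist)
      then show "poly (p k) x * (1 + real n * \<bar>x - cos (\<phi> k)\<bar>) ^ (2 * K)
          \<le> (fejer n (\<theta> + \<phi> k) + fejer n (\<theta> - \<phi> k)) * (9 * (real n)\<^sup>2) ^ K / (2 * c)"
        using c_pos unfolding x p by (simp add: divide_right_mono distrib_right)
    qed
    \<comment> \<open>The single Fejer factors left over sum to n N for each sign. With
      \<open>c\<close> at least n^(2K+2) and N = (K+1) n, every power of \<open>n\<close> then
      cancels.\<close>
    also have "\<dots> = real n * real N * (9 * (real n)\<^sup>2) ^ K / c"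
      by (simp add: sum_divide_distrib[symmetric] sum_distrib_right[symmetric] sum.distrib
          f_plus f_minus)
    also have "\<dots> \<le> real n * real N * (9 * (real n)\<^sup>2) ^ K / (real n)\<^sup>2 ^ Suc K"
      using assms c_ge by (intro divide_left_mono mult_nonneg_nonneg) (auto intro!: mult_pos_pos c_pos)
    also have "\<dots> = 9 ^ K * Suc K"
      using assms by (simp add: N_def field_simps power2_eq_square power_mult_distrib)
    finally show "(\<Sum>k<N. poly (p k) x * (1 + real n * \<bar>x - cos (\<phi> k)\<bar>) ^ (2 * K))
        \<le> 9 ^ K * Suc K" .
  qed
qed

text \<open>Odd powers cancel in the average over u and -u, and u^i with even i is the square of u
  to the power i/2. The degree bound is generous but sufficient.\<close>

lemma even_part_poly:
  fixes p :: "real poly"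
  shows "\<exists>q :: real poly. degree q \<le> degree p \<and> (\<forall>u. poly q (u\<^sup>2) = (poly p u + poly p (- u)) / 2)"
proof -
  let ?q = "\<Sum>i\<le>degree p. if even i then monom (coeff p i) (i div 2) else 0"
  have "degree ?q \<le> degree p"
    by (intro degree_sum_le) (auto intro: order_trans[OF degree_monom_le])
  moreover have "poly ?q (u\<^sup>2) = (poly p u + poly p (- u)) / 2" for u
  proof -
    have "poly ?q (u\<^sup>2) = (\<Sum>i\<le>degree p. (coeff p i * u ^ i + coeff p i * (- u) ^ i) / 2)"
      unfolding poly_sum
    proof (intro sum.cong refl)
      fix i
      show "poly (if even i then monom (coeff p i) (i div 2) else 0) (u\<^sup>2)
          = (coeff p i * u ^ i + coeff p i * (- u) ^ i) / 2"
        by (cases "even i") (auto simp: poly_monom power_mult[symmetric])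
    qed
    then show ?thesis
      by (simp add: poly_altdef sum_divide_distrib[symmetric] sum.distrib)
  qed
  ultimately show ?thesis by blast
qed

text \<open>Serves a variable u of which only the square is a polynomial in the point. Taking even
  parts preserves nonnegativity, the sum and, for u \<ge> 0, the localization.\<close>

lemma localized_partition_sqrt:
  fixes n K :: nat
  assumes "n \<ge> 1"
  obtains N :: nat and t :: "nat \<Rightarrow> real" and p :: "nat \<Rightarrow> real poly" where
    "\<And>k. degree (p k) \<le> Suc K * n"
    "\<And>k u. 0 \<le> u \<Longrightarrow> u \<le> 1 \<Longrightarrow> 0 \<le> poly (p k) (u\<^sup>2)"
    "\<And>u. 0 \<le> u \<Longrightarrow> u \<le> 1 \<Longrightarrow> (\<Sum>k<N. poly (p k) (u\<^sup>2)) = 1"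
    "\<And>u. 0 \<le> u \<Longrightarrow> u \<le> 1 \<Longrightarrow>
       (\<Sum>k<N. poly (p k) (u\<^sup>2) * (1 + real n * \<bar>u - t k\<bar>) ^ (2 * K)) \<le> 9 ^ K * Suc K"
proof -
  obtain N :: nat and t :: "nat \<Rightarrow> real" and p :: "nat \<Rightarrow> real poly" where
    p: "\<And>k. degree (p k) \<le> Suc K * n"
    "\<And>k x. \<bar>x\<bar> \<le> 1 \<Longrightarrow> 0 \<le> poly (p k) x"
    "\<And>x. \<bar>x\<bar> \<le> 1 \<Longrightarrow> (\<Sum>k<N. poly (p k) x) = 1"
    "\<And>x. \<bar>x\<bar> \<le> 1 \<Longrightarrow>
       (\<Sum>k<N. poly (p k) x * (1 + real n * \<bar>x - t k\<bar>) ^ (2 * K)) \<le> 9 ^ K * Suc K"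
    by (rule localized_partition_cos[OF assms, where K = K]) (rule that)
  obtain q where q: "\<And>k. degree (q k) \<le> degree (p k)"
    "\<And>k u. poly (q k) (u\<^sup>2) = (poly (p k) u + poly (p k) (- u)) / 2"
  proof -
    have "\<forall>k. \<exists>q :: real poly. degree q \<le> degree (p k) \<and>
        (\<forall>u. poly q (u\<^sup>2) = (poly (p k) u + poly (p k) (- u)) / 2)"
      by (intro allI even_part_poly)
    from choice[OF this] show ?thesis using that by blast
  qed
  show thesis
  proof
    show "degree (q k) \<le> Suc K * n" for k using p(1) q(1) order_trans by blast
    show "0 \<le> poly (q k) (u\<^sup>2)" if "0 \<le> u" "u \<le> 1" for k u
      using p(2)[of u k] p(2)[of "- u" k] that by (simp add: q)
    show "(\<Sum>k<N. poly (q k) (u\<^sup>2)) = 1" if "0 \<le> u" "u \<le> 1" for u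
      using p(3)[of u] p(3)[of "- u"] that
      by (simp add: q sum_divide_distrib[symmetric] sum.distrib)
    \<comment> \<open>The centres become |t k|: for u \<ge> 0 the distance from u to |t k| is at
      most the distance from u to t k and from -u to t k, so both halves of the even part stay
      localized.\<close>
    show "(\<Sum>k<N. poly (q k) (u\<^sup>2) * (1 + real n * \<bar>u - \<bar>t k\<bar>\<bar>) ^ (2 * K)) \<le> 9 ^ K * Suc K"
      if u: "0 \<le> u" "u \<le> 1" for u
    proof -
      have "poly (q k) (u\<^sup>2) * (1 + real n * \<bar>u - \<bar>t k\<bar>\<bar>) ^ (2 * K)
          \<le> (poly (p k) u * (1 + real n * \<bar>u - t k\<bar>) ^ (2 * K)
            + poly (p k) (- u) * (1 + real n * \<bar>- u - t k\<bar>) ^ (2 * K)) / 2" for k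
      proof -
        have "poly (p k) u * (1 + real n * \<bar>u - \<bar>t k\<bar>\<bar>) ^ (2 * K)
            \<le> poly (p k) u * (1 + real n * \<bar>u - t k\<bar>) ^ (2 * K)"
          using u by (intro mult_left_mono power_mono add_left_mono p(2)) auto
        moreover have "poly (p k) (- u) * (1 + real n * \<bar>u - \<bar>t k\<bar>\<bar>) ^ (2 * K)
            \<le> poly (p k) (- u) * (1 + real n * \<bar>- u - t k\<bar>) ^ (2 * K)"
          using u by (intro mult_left_mono power_mono add_left_mono p(2)) auto
        ultimately show ?thesis by (simp add: q distrib_right)
      qed
      then have "(\<Sum>k<N. poly (q k) (u\<^sup>2) * (1 + real n * \<bar>u - \<bar>t k\<bar>\<bar>) ^ (2 * K))
          \<le> (\<Sum>k<N. (poly (p k) u * (1 + real n * \<bar>u - t k\<bar>) ^ (2 * K)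
            + poly (p k) (- u) * (1 + real n * \<bar>- u - t k\<bar>) ^ (2 * K)) / 2)"
        by (rule sum_mono)
      also have "\<dots> \<le> 9 ^ K * Suc K"
        using p(4)[of u] p(4)[of "- u"] u
        by (simp add: sum_divide_distrib[symmetric] sum.distrib)
      finally show ?thesis .
    qed
  qed
qed

section \<open>Polynomials in several variables\<close>

definition monomial_fun :: "('a :: euclidean_space \<Rightarrow> nat) \<Rightarrow> 'a \<Rightarrow> real" where
  "monomial_fun \<alpha> x = (\<Prod>b\<in>Basis. (x \<bullet> b) ^ \<alpha> b)"

definition multi_indices :: "nat \<Rightarrow> ('a :: euclidean_space \<Rightarrow> nat) set" where
  "multi_indices s = {\<alpha> \<in> Basis \<rightarrow>\<^sub>E UNIV. (\<Sum>b\<in>Basis. \<alpha> b) \<le> s}"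

lemma poly_space_iff:
  "p \<in> poly_space s \<longleftrightarrow> (\<exists>a. \<forall>x. p x = (\<Sum>\<alpha>\<in>multi_indices s. a \<alpha> * monomial_fun \<alpha> x))"
  by (simp add: poly_space_def multi_indices_def monomial_fun_def)

lemma finite_multi_indices': "finite (multi_indices s)"
  unfolding multi_indices_def by (rule finite_multi_indices)

lemma poly_space_monomial:
  assumes "(\<Sum>b\<in>Basis. \<alpha> b) \<le> s"
  shows "monomial_fun \<alpha> \<in> poly_space s"
proof -
  \<comment> \<open>The elements of \<open>multi_indices\<close> are \<open>undefined\<close>
    outside \<open>Basis\<close>, whereas \<alpha> is arbitrary there; the monomial sees only the
    values on \<open>Basis\<close>.\<close>
  let ?\<beta> = "restrict \<alpha> Basis"
  have "?\<beta> \<in> multi_indices s" using assms by (auto simp: multi_indices_def)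
  moreover have "monomial_fun \<alpha> x = monomial_fun ?\<beta> x" for x by (simp add: monomial_fun_def)
  ultimately show ?thesis
    unfolding poly_space_iff
    by (intro exI[of _ "\<lambda>\<gamma>. if \<gamma> = ?\<beta> then 1 else 0"])
      (simp add: if_distrib[of "\<lambda>c. c * _"] finite_multi_indices' cong: if_cong)
qed

lemma poly_space_cmult:
  assumes "p \<in> poly_space s"
  shows "(\<lambda>x. c * p x) \<in> poly_space s"
proof -
  obtain a where "\<forall>x. p x = (\<Sum>\<alpha>\<in>multi_indices s. a \<alpha> * monomial_fun \<alpha> x)"
    using assms unfolding poly_space_iff by blast
  then show ?thesis
    unfolding poly_space_iff
    by (intro exI[of _ "\<lambda>\<alpha>. c * a \<alpha>"]) (simp add: sum_distrib_left mult.assoc)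
qed

lemma poly_space_const: "(\<lambda>x. c) \<in> poly_space s"
  using poly_space_cmult[OF poly_space_monomial[of "\<lambda>_. 0" s], of c]
  by (simp add: monomial_fun_def)

lemma poly_space_add:
  assumes "p \<in> poly_space s" "q \<in> poly_space s"
  shows "(\<lambda>x. p x + q x) \<in> poly_space s"
proof -
  obtain a b where "\<forall>x. p x = (\<Sum>\<alpha>\<in>multi_indices s. a \<alpha> * monomial_fun \<alpha> x)"
    "\<forall>x. q x = (\<Sum>\<alpha>\<in>multi_indices s. b \<alpha> * monomial_fun \<alpha> x)"
    using assms unfolding poly_space_iff by blast
  then show ?thesis
    unfolding poly_space_iff
    by (intro exI[of _ "\<lambda>\<alpha>. a \<alpha> + b \<alpha>"]) (simp add: distrib_right sum.distrib)
qed

lemma poly_space_sum: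
  assumes "\<And>i. i \<in> I \<Longrightarrow> p i \<in> poly_space s"
  shows "(\<lambda>x. \<Sum>i\<in>I. p i x) \<in> poly_space s"
  using assms
  by (induction I rule: infinite_finite_induct) (auto intro: poly_space_add poly_space_const)

text \<open>Exponents add under multiplication. The double sum need not be collected by total
  exponent, since closure under sums and \<open>poly_space_monomial\<close> handle each term
  separately.\<close>

lemma poly_space_mult:
  assumes "p \<in> poly_space s" "q \<in> poly_space t"
  shows "(\<lambda>x. p x * q x) \<in> poly_space (s + t)"
proof -
  obtain a b where p: "\<And>x. p x = (\<Sum>\<alpha>\<in>multi_indices s. a \<alpha> * monomial_fun \<alpha> x)"
    and q: "\<And>x. q x = (\<Sum>\<alpha>\<in>multi_indices t. b \<alpha> * monomial_fun \<alpha> x)"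
    using assms unfolding poly_space_iff by blast
  have pq: "p x * q x = (\<Sum>\<alpha>\<in>multi_indices s. \<Sum>\<beta>\<in>multi_indices t.
      (a \<alpha> * b \<beta>) * monomial_fun (\<lambda>i. \<alpha> i + \<beta> i) x)" for x
    unfolding p q sum_product
    by (intro sum.cong refl) (simp add: monomial_fun_def power_add prod.distrib)
  show ?thesis
    unfolding pq
    by (intro poly_space_sum poly_space_cmult poly_space_monomial)
      (auto simp: multi_indices_def sum.distrib intro: add_mono)
qed

text \<open>The constant 1 counts as a polynomial of degree at most \<open>t - s\<close>, and
  multiplying by it raises the bound to \<open>t\<close>.\<close>

lemma poly_space_mono:
  assumes "p \<in> poly_space s" "s \<le> t"
  shows "p \<in> poly_space t"
  using poly_space_mult[OF assms(1) poly_space_const[of 1 "t - s"]] assms(2) by simp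

lemma poly_space_power: "p \<in> poly_space s \<Longrightarrow> (\<lambda>x. p x ^ k) \<in> poly_space (k * s)"
  by (induction k) (auto intro: poly_space_mult poly_space_const)

lemma poly_space_prod:
  assumes "\<And>i. i \<in> I \<Longrightarrow> p i \<in> poly_space s"
  shows "(\<lambda>x. \<Prod>i\<in>I. p i x) \<in> poly_space (card I * s)"
  using assms
  by (induction I rule: infinite_finite_induct) (auto intro: poly_space_mult poly_space_const)

lemma poly_space_poly:
  assumes "p \<in> poly_space s" "degree q * s \<le> t"
  shows "(\<lambda>x. poly q (p x)) \<in> poly_space t"
  unfolding poly_altdef
proof (intro poly_space_sum poly_space_cmult)
  fix i assume "i \<in> {..degree q}"
  then have "i * s \<le> t" using assms(2) by (meson atMost_iff le_trans mult_le_mono1)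
  then show "(\<lambda>x. p x ^ i) \<in> poly_space t"
    by (rule poly_space_mono[OF poly_space_power[OF assms(1)]])
qed

lemma poly_space_inner:
  fixes v :: "'a :: euclidean_space"
  shows "(\<lambda>x. x \<bullet> v) \<in> poly_space 1"
proof -
  have *: "(\<lambda>x. x \<bullet> b) \<in> poly_space 1" if "b \<in> Basis" for b :: 'a
  proof -
    have "monomial_fun (\<lambda>c. if c = b then 1 else 0) = (\<lambda>x. x \<bullet> b)"
      using that by (auto simp: monomial_fun_def fun_eq_iff if_distrib[of "\<lambda>k. _ ^ k"] cong: if_cong)
    then show ?thesis
      using poly_space_monomial[of "\<lambda>c. if c = b then 1 else 0" 1] that by simp
  qed
  have "(\<lambda>x. \<Sum>b\<in>Basis. (v \<bullet> b) * (x \<bullet> b)) \<in> poly_space 1"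
    by (intro poly_space_sum poly_space_cmult *)
  moreover have "x \<bullet> v = (\<Sum>b\<in>Basis. (v \<bullet> b) * (x \<bullet> b))" for x
    by (subst euclidean_inner) (simp add: mult.commute)
  ultimately show ?thesis by presburger
qed

lemma poly_space_norm_diff_squared:
  fixes w :: "'a :: euclidean_space"
  shows "(\<lambda>x. (norm (x - w))\<^sup>2) \<in> poly_space 2"
proof -
  have eq: "(norm (x - w))\<^sup>2 = (\<Sum>b\<in>Basis. (x \<bullet> b + - (w \<bullet> b)) ^ 2)" for x
    unfolding power2_norm_eq_inner
    by (subst euclidean_inner) (simp add: inner_diff_left power2_eq_square)
  have "(\<lambda>x. (x \<bullet> b + - (w \<bullet> b)) ^ 2) \<in> poly_space (2 * 1)" for b
    by (intro poly_space_power poly_space_add poly_space_inner poly_space_const)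
  then show ?thesis unfolding eq by (intro poly_space_sum) simp
qed

section \<open>Tangent balls at the boundary\<close>

text \<open>\<open>G\<close> is the gradient. The entry bound on the Hessian makes it Lipschitz, and
  the mean value inequality for \<open>f\<close> minus its linear part at \<open>u\<close> on the
  ball of radius |h| gives the quadratic error.\<close>

lemma hessian_bounded_taylor:
  fixes f :: "real ^ 'd \<Rightarrow> real"
  assumes "C2_hessian_bounded M f"
  obtains G where "\<And>u h. \<bar>f (u + h) - f u - G u \<bullet> h\<bar> \<le> (real CARD('d))\<^sup>2 * M * (norm h)\<^sup>2"
proof -
  obtain g H where f: "\<And>x. (f has_derivative (\<lambda>h. g x \<bullet> h)) (at x)"
    and g: "\<And>x. (g has_derivative (\<lambda>h. H x *v h)) (at x)"
    and H: "\<And>i k x. \<bar>H x $ i $ k\<bar> \<le> M"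
    using assms unfolding C2_hessian_bounded_def by blast
  define B where "B = (real CARD('d))\<^sup>2 * M"
  have "0 \<le> M" using H abs_ge_zero order_trans by blast
  then have B: "0 \<le> B" by (simp add: B_def)
  have g_lip: "norm (g x - g y) \<le> B * norm (x - y)" for x y
  proof (rule differentiable_bound[of UNIV g "\<lambda>x h. H x *v h"])
    show "onorm ((*v) (H x)) \<le> B" for x
      using onorm_le_matrix_component[of "H x" M] H by (simp add: B_def power2_eq_square)
  qed (use g in auto)
  have "\<bar>f (u + h) - f u - g u \<bullet> h\<bar> \<le> B * (norm h)\<^sup>2" for u h
  proof -
    let ?F = "\<lambda>x. f x - g u \<bullet> x"
    have "norm (?F (u + h) - ?F u) \<le> (B * norm h) * norm (u + h - u)"
    proof (rule differentiable_bound[of "cball u (norm h)" ?F "\<lambda>x k. g x \<bullet> k - g u \<bullet> k"])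
      fix x assume x: "x \<in> cball u (norm h)"
      show "(?F has_derivative (\<lambda>k. g x \<bullet> k - g u \<bullet> k)) (at x within cball u (norm h))"
        by (intro has_derivative_diff has_derivative_at_withinI[OF f] has_derivative_inner_right
            has_derivative_ident)
      show "onorm (\<lambda>k. g x \<bullet> k - g u \<bullet> k) \<le> B * norm h"
      proof (rule onorm_le)
        fix k :: "real ^ 'd"
        have "norm (g x - g u) \<le> B * norm h"
          using x by (intro order_trans[OF g_lip] mult_left_mono B)
            (simp add: dist_norm norm_minus_commute)
        then have "norm (g x - g u) * norm k \<le> B * norm h * norm k" by (rule mult_right_mono) simp
        then show "norm (g x \<bullet> k - g u \<bullet> k) \<le> B * norm h * norm k"
          using Cauchy_Schwarz_ineq2[of "g x - g u" k] by (simp add: inner_diff_left)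
      qed
    qed (auto simp: dist_norm)
    then show ?thesis by (simp add: inner_add_right power2_eq_square algebra_simps)
  qed
  then show ?thesis using that unfolding B_def by blast
qed

text \<open>A uniform two-sided ball condition. In a chart, the height below the graph is a defining
  function that is linear in the normal direction up to a quadratic error; inside a tangent ball of
  small radius the linear term dominates and fixes the sign.\<close>

lemma C2_domain_tangent_balls:
  fixes D :: "((real ^ 'd) \<times> real) set"
  assumes "C2_domain D"
  obtains r where "r > 0" "\<And>z. z \<in> frontier D \<Longrightarrow>
    \<exists>v. norm v = 1 \<and> ball (z + r *\<^sub>R v) r \<inter> closure D = {} \<and> ball (z - r *\<^sub>R v) r \<subseteq> D"
proof -
  obtain \<delta> M :: real and J :: nat and U :: "nat \<Rightarrow> ((real ^ 'd) \<times> real) set" where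
    "open D" and \<delta>: "\<delta> > 0" and M: "M > 0"
    and U: "\<forall>j\<in>{1..J}. open (U j) \<and> connected (U j)"
    and cover': "\<forall>x\<in>D. infdist x (frontier D) < \<delta> \<longrightarrow>
           (\<exists>j\<in>{1..J}. x \<in> U j \<and> infdist x (frontier (U j)) > \<delta>)"
    and chart': "\<forall>j\<in>{1..J}. \<exists>(a :: (real ^ 'd) \<times> real)
             (A :: (real ^ 'd) \<times> real \<Rightarrow> (real ^ 'd) \<times> real) (f :: real ^ 'd \<Rightarrow> real).
           orthogonal_transformation A \<and> C2_hessian_bounded M f \<and>
           D \<inter> U j = {x \<in> U j. snd (A (x - a)) < f (fst (A (x - a)))}"
    using assms unfolding C2_domain_def by (elim conjE exE) (rule that)
  note U_open = bspec[OF U, THEN conjunct1]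
    and cover = bspec[OF cover', THEN mp] and chart = bspec[OF chart']
  define B where "B = (real CARD('d))\<^sup>2 * M"
  \<comment> \<open>The bound \<delta>/4 keeps both tangent balls within \<delta>/2 of the boundary
    point and so inside one chart; the bound 1/(2B) turns the Taylor error into |p - z|^2 / (2r),
    the quantity in the equation of a ball of radius r.\<close>
  define r where "r = min (\<delta> / 4) (1 / (2 * B))"
  have B: "B > 0" using M by (simp add: B_def)
  have r: "r > 0" "r \<le> \<delta> / 4" "r \<le> 1 / (2 * B)" using \<delta> B by (auto simp: r_def)
  have rB: "B \<le> 1 / (2 * r)" using r B by (simp add: field_simps)
  show thesis
  proof
    show "r > 0" by fact
    fix z assume z: "z \<in> frontier D"
    then have zc: "z \<in> closure D" and zD: "z \<notin> D"
      using \<open>open D\<close> by (auto simp: frontier_def interior_open)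
    \<comment> \<open>The covering condition concerns points of \<open>D\<close> only, so the chart
      is chosen at a point \<open>x\<close> of \<open>D\<close> near \<open>z\<close>; its
      \<delta>-ball contains the \<delta>/2-ball around \<open>z\<close>.\<close>
    obtain x where x: "x \<in> D" "dist x z < \<delta> / 2"
      using zc \<delta> by (metis closure_approachable half_gt_zero)
    have "infdist x (frontier D) < \<delta>"
      using infdist_le[OF z, of x] x(2) \<delta> by linarith
    from cover[OF x(1) this] obtain j where j: "j \<in> {1..J}" "x \<in> U j"
      "infdist x (frontier (U j)) > \<delta>" by blast
    have xU: "ball x \<delta> \<subseteq> U j"
    proof (rule ccontr)
      assume "\<not> ball x \<delta> \<subseteq> U j"
      then have "ball x \<delta> \<inter> frontier (U j) \<noteq> {}"
        using j(2) \<delta> centre_in_ball[of x \<delta>] by (intro connected_Int_frontier) (simp, blast, blast)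
      then obtain p where "p \<in> frontier (U j)" "dist x p < \<delta>" by auto
      then show False using infdist_le[of p "frontier (U j)" x] j(3) by linarith
    qed
    have zU: "p \<in> U j" if "dist z p < \<delta> / 2" for p
    proof -
      have "dist x p < \<delta>" using that x(2) dist_triangle[of x p z] by linarith
      then show ?thesis using xU by auto
    qed
    obtain a :: "(real ^ 'd) \<times> real" and A and f :: "real ^ 'd \<Rightarrow> real" where A: "orthogonal_transformation A" and f: "C2_hessian_bounded M f"
      and DU: "D \<inter> U j = {x \<in> U j. snd (A (x - a)) < f (fst (A (x - a)))}"
      using chart[OF j(1)] by (elim exE conjE) (rule that)
    obtain G where taylor: "\<And>u h. \<bar>f (u + h) - f u - G u \<bullet> h\<bar> \<le> B * (norm h)\<^sup>2"
      using hessian_bounded_taylor[OF f] unfolding B_def by metis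
    define \<phi> where "\<phi> p = f (fst (A (p - a))) - snd (A (p - a))" for p
    have linA: "linear A" using A by (simp add: orthogonal_transformation_def)
    obtain g :: "real ^ 'd \<Rightarrow> real ^ 'd" where g: "\<And>x. (f has_derivative (\<lambda>h. g x \<bullet> h)) (at x)"
      using f unfolding C2_hessian_bounded_def by blast
    have "isCont f x" for x by (rule has_derivative_continuous[OF g])
    then have f_cont: "continuous_on UNIV f" by (simp add: continuous_at_imp_continuous_on)
    have "bounded_linear A" using linA by (simp add: linear_conv_bounded_linear)
    then have A_cont: "continuous_on UNIV (\<lambda>p. A (p - a))"
      by (rule bounded_linear.continuous_on) (rule continuous_on_diff[OF continuous_on_id continuous_on_const])
    have \<phi>_cont: "continuous_on UNIV \<phi>"
      unfolding \<phi>_def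
      by (rule continuous_on_diff[OF continuous_on_compose2[OF f_cont continuous_on_fst[OF A_cont]]
            continuous_on_snd[OF A_cont]]) simp
    have D_iff: "p \<in> D \<longleftrightarrow> \<phi> p > 0" if "p \<in> U j" for p
      using DU that by (auto simp: \<phi>_def)
    have "\<phi> z = 0"
    proof (rule antisym)
      show "\<phi> z \<le> 0" using D_iff[of z] zD zU[of z] \<delta> by auto
      show "0 \<le> \<phi> z"
      proof (rule ccontr)
        assume "\<not> 0 \<le> \<phi> z"
        have "open (U j \<inter> {p. \<phi> p < 0})"
          using \<phi>_cont by (intro open_Int U_open j open_Collect_less) auto
        moreover have "U j \<inter> {p. \<phi> p < 0} \<inter> D = {}" using D_iff by force
        ultimately have "U j \<inter> {p. \<phi> p < 0} \<inter> closure D = {}"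
          by (simp add: open_Int_closure_eq_empty)
        then show False using zc zU[of z] \<delta> \<open>\<not> 0 \<le> \<phi> z\<close> by auto
      qed
    qed
    define u where "u = fst (A (z - a))"
    define c where "c = sqrt (1 + (norm (G u))\<^sup>2)"
    have c: "c \<ge> 1" by (simp add: c_def)
    have c2: "c\<^sup>2 = 1 + (norm (G u))\<^sup>2" by (simp add: c_def)
    \<comment> \<open>In chart coordinates this is the upward unit normal (-G u, 1)/c of the graph.
      It points out of \<open>D\<close>, which lies below the graph.\<close>
    obtain v where v: "A v = (- (1 / c) *\<^sub>R G u, 1 / c)"
      using orthogonal_transformation_surj[OF A] by (metis surj_def)
    have "(norm (A v))\<^sup>2 = ((norm (G u))\<^sup>2 + 1) / c\<^sup>2"
      unfolding v power2_norm_eq_inner by (simp add: power2_eq_square add_divide_distrib)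
    then have "(norm (A v))\<^sup>2 = 1" using c by (simp add: c2[symmetric] add.commute)
    then have "norm (A v) = 1" by (metis norm_ge_zero abs_of_nonneg power2_eq_1_iff abs_1 abs_minus_cancel)
    then have nv: "norm v = 1" using A by (simp add: orthogonal_transformation_norm)
    \<comment> \<open>Below only \<open>c \<ge> 1\<close> is used, so \<open>r\<close> depends on the Hessian bound but not on the gradient.\<close>
    have key: "\<bar>\<phi> p + c * ((p - z) \<bullet> v)\<bar> \<le> (norm (p - z))\<^sup>2 / (2 * r)" for p
    proof -
      obtain h k where hk: "A (p - z) = (h, k)" by fastforce
      have "A (p - a) = A (z - a) + A (p - z)"
        by (simp add: linear_add[OF linA, symmetric])
      then have "\<phi> p = f (u + h) - snd (A (z - a)) - k"
        by (simp add: \<phi>_def hk u_def)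
      also have "snd (A (z - a)) = f u" using \<open>\<phi> z = 0\<close> by (simp add: \<phi>_def u_def)
      finally have 1: "\<phi> p = f (u + h) - f u - k" .
      have "(p - z) \<bullet> v = A (p - z) \<bullet> A v"
        using A unfolding orthogonal_transformation_def by metis
      then have 2: "c * ((p - z) \<bullet> v) = k - G u \<bullet> h"
        using c by (simp add: hk v inner_commute field_simps)
      have "norm h \<le> norm (A (p - z))" unfolding hk by (metis norm_fst_le fst_conv)
      then have "norm h \<le> norm (p - z)" unfolding orthogonal_transformation_norm[OF A] .
      then have "B * (norm h)\<^sup>2 \<le> 1 / (2 * r) * (norm (p - z))\<^sup>2"
        using rB r by (intro mult_mono power_mono) auto
      then show ?thesis using taylor[of u h] unfolding 1 2 by simp
    qed
    \<comment> \<open>The sign \<sigma> treats the exterior ball (1) and the interior ball (-1)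
      together; expanding the square in the ball condition gives the inequality.\<close>
    have ball_iff: "(norm (p - z))\<^sup>2 / (2 * r) < \<sigma> * ((p - z) \<bullet> v) \<and> p \<in> U j"
      if p: "p \<in> ball (z + (\<sigma> * r) *\<^sub>R v) r" and \<sigma>: "\<bar>\<sigma>\<bar> = 1" for p \<sigma>
    proof
      have "(norm (p - z - (\<sigma> * r) *\<^sub>R v))\<^sup>2 < r\<^sup>2"
        using p r by (intro power_strict_mono) (auto simp: dist_norm norm_minus_commute diff_diff_eq)
      also have "(norm (p - z - (\<sigma> * r) *\<^sub>R v))\<^sup>2
          = (norm (p - z))\<^sup>2 - 2 * \<sigma> * r * ((p - z) \<bullet> v) + (\<sigma> * \<sigma>) * r\<^sup>2 * (v \<bullet> v)"
        unfolding power2_norm_eq_inner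
        by (simp add: inner_diff_left inner_diff_right inner_commute power2_eq_square algebra_simps)
      also have "\<dots> = (norm (p - z))\<^sup>2 - 2 * \<sigma> * r * ((p - z) \<bullet> v) + r\<^sup>2"
        using \<sigma> nv by (metis abs_mult_self_eq dot_square_norm mult.commute mult_1 power_one)
      finally show "(norm (p - z))\<^sup>2 / (2 * r) < \<sigma> * ((p - z) \<bullet> v)"
        using r by (simp add: field_simps)
      have "dist z p \<le> norm ((\<sigma> * r) *\<^sub>R v) + dist (z + (\<sigma> * r) *\<^sub>R v) p"
        using dist_triangle[of z p "z + (\<sigma> * r) *\<^sub>R v"] by (simp add: dist_norm)
      also have "\<dots> < r + r" using p nv \<sigma> r by (simp add: abs_mult)
      finally show "p \<in> U j" using r by (intro zU) linarith
    qed
    show "\<exists>v. norm v = 1 \<and> ball (z + r *\<^sub>R v) r \<inter> closure D = {} \<and> ball (z - r *\<^sub>R v) r \<subseteq> D"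
    proof (intro exI[of _ v] conjI)
      show "norm v = 1" by (rule nv)
      have "p \<notin> D" if "p \<in> ball (z + r *\<^sub>R v) r" for p
      proof -
        have *: "(norm (p - z))\<^sup>2 / (2 * r) < (p - z) \<bullet> v" "p \<in> U j"
          using ball_iff[of p 1] that by auto
        moreover have "0 \<le> (norm (p - z))\<^sup>2 / (2 * r)" using r by simp
        ultimately have "1 * ((p - z) \<bullet> v) \<le> c * ((p - z) \<bullet> v)"
          by (intro mult_right_mono[OF c]) linarith
        then have "\<phi> p < 0" using * key[of p] by linarith
        then show ?thesis using D_iff[OF *(2)] by simp
      qed
      then have "ball (z + r *\<^sub>R v) r \<inter> D = {}" by blast
      then show "ball (z + r *\<^sub>R v) r \<inter> closure D = {}"
        using open_Int_closure_eq_empty open_ball by blast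
      show "ball (z - r *\<^sub>R v) r \<subseteq> D"
      proof
        fix p assume "p \<in> ball (z - r *\<^sub>R v) r"
        then have *: "(norm (p - z))\<^sup>2 / (2 * r) < - ((p - z) \<bullet> v)" "p \<in> U j"
          using ball_iff[of p "- 1"] by auto
        moreover have "0 \<le> (norm (p - z))\<^sup>2 / (2 * r)" using r by simp
        ultimately have "1 * (- ((p - z) \<bullet> v)) \<le> c * (- ((p - z) \<bullet> v))"
          by (intro mult_right_mono[OF c]) linarith
        then have "\<phi> p > 0" using * key[of p] by linarith
        then show "p \<in> D" using D_iff[OF *(2)] by simp
      qed
    qed
  qed
qed

section \<open>The boundary distance and a quadric\<close>

text \<open>Second-order expansion of the norm: with q = h \<bullet> v + |h|^2/(2a), the square of a
  + q exceeds that of the left side by exactly q^2. Taking roots requires a + q \<ge> 0, which is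
  shown first.\<close>

lemma norm_add_unit_le:
  fixes h v :: "'a :: real_inner"
  assumes "norm v = 1" "a > 0"
  shows "norm (h + a *\<^sub>R v) \<le> a + h \<bullet> v + (norm h)\<^sup>2 / (2 * a)"
proof -
  let ?q = "h \<bullet> v + (norm h)\<^sup>2 / (2 * a)"
  have "(h \<bullet> v)\<^sup>2 \<le> (norm h)\<^sup>2"
    using Cauchy_Schwarz_ineq2[of h v] assms(1) by (metis abs_le_square_iff abs_norm_cancel mult.right_neutral)
  then have "0 \<le> (a\<^sup>2 + (a + h \<bullet> v)\<^sup>2 + ((norm h)\<^sup>2 - (h \<bullet> v)\<^sup>2)) / (2 * a)"
    using assms(2) by (intro divide_nonneg_pos add_nonneg_nonneg) auto
  also have "\<dots> = a + ?q"
    using assms(2) by (simp add: field_simps power2_eq_square)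
  finally have nonneg: "0 \<le> a + ?q" .
  have vv: "v \<bullet> v = 1" using assms(1) by (simp add: dot_square_norm)
  have "(norm (h + a *\<^sub>R v))\<^sup>2 = (norm h)\<^sup>2 + 2 * a * (h \<bullet> v) + a\<^sup>2 * (v \<bullet> v)"
    unfolding power2_norm_eq_inner
    by (simp add: inner_add_left inner_add_right inner_commute power2_eq_square algebra_simps)
  also have "\<dots> \<le> (norm h)\<^sup>2 + 2 * a * (h \<bullet> v) + a\<^sup>2 + ?q\<^sup>2" unfolding vv by simp
  also have "\<dots> = (a + ?q)\<^sup>2"
    using assms(2) by (simp add: field_simps power2_eq_square)
  finally show ?thesis using power2_le_imp_le[OF _ nonneg] by (simp add: add.assoc)
qed

lemma sqrt_diff_le_sqrt_diff:
  assumes "0 \<le> a" "a \<le> b"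
  shows "\<bar>sqrt b - sqrt a\<bar> \<le> sqrt (b - a)"
  using sqrt_add_le_add_sqrt[of a "b - a"] assms by simp

text \<open>The root factors as sqrt(a) sqrt(a + 2r), whose second factor is increasing and at least
  sqrt(2r). For a = |x - w| - r, the radicand a^2 + 2ra is the quadric |x - w|^2 - r^2.\<close>

lemma sqrt_diff_le_sqrt_square_diff:
  assumes "0 \<le> a" "0 \<le> b" "r > 0"
  shows "sqrt (2 * r) * \<bar>sqrt a - sqrt b\<bar> \<le> \<bar>sqrt (a\<^sup>2 + 2 * r * a) - sqrt (b\<^sup>2 + 2 * r * b)\<bar>"
proof -
  have *: "sqrt (2 * r) * (sqrt b - sqrt a) \<le> sqrt (b\<^sup>2 + 2 * r * b) - sqrt (a\<^sup>2 + 2 * r * a)"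
    if "0 \<le> a" "a \<le> b" for a b
  proof -
    have sq: "sqrt (c\<^sup>2 + 2 * r * c) = sqrt c * sqrt (c + 2 * r)" for c
      by (simp add: real_sqrt_mult[symmetric] power2_eq_square algebra_simps)
    have "sqrt (2 * r) * (sqrt b - sqrt a) \<le> sqrt (b + 2 * r) * (sqrt b - sqrt a)"
      using that by (intro mult_right_mono) auto
    also have "\<dots> \<le> sqrt (b + 2 * r) * (sqrt b - sqrt a) + sqrt a * (sqrt (b + 2 * r) - sqrt (a + 2 * r))"
      using that assms(3) by simp
    finally show ?thesis unfolding sq by (simp add: algebra_simps)
  qed
  show ?thesis
  proof (cases "a \<le> b")
    case True
    then have "\<bar>sqrt a - sqrt b\<bar> = sqrt b - sqrt a" by simp
    then show ?thesis using *[OF assms(1) True] by simp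
  next
    case False
    then show ?thesis using *[of b a] assms(2) by simp
  qed
qed

text \<open>The segment from \<open>x\<close> to \<open>w\<close> crosses the frontier at a point of
  \<Omega>, which has distance at least \<open>r\<close> from \<open>w\<close>.\<close>

lemma exterior_ball_infdist_le:
  fixes \<Omega> :: "'a :: euclidean_space set"
  assumes "closed \<Omega>" "ball w r \<inter> \<Omega> = {}" "r > 0" "x \<in> \<Omega>"
  shows "r + infdist x (frontier \<Omega>) \<le> norm (x - w)"
proof -
  have "w \<notin> \<Omega>" using assms(2,3) centre_in_ball[of w r] by blast
  then have "closed_segment x w \<inter> frontier \<Omega> \<noteq> {}"
    using assms(4) ends_in_segment[of x w] by (intro connected_Int_frontier connected_segment) blast+
  then obtain p where p: "p \<in> closed_segment x w" "p \<in> frontier \<Omega>" by blast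
  have "p \<in> \<Omega>" using p(2) assms(1) frontier_subset_closed by blast
  then have "r \<le> dist w p" using assms(2) by (meson disjoint_iff linorder_not_less mem_ball)
  moreover have "dist x w = dist x p + dist p w"
    using p(1) by (simp add: between_mem_segment[symmetric] between)
  ultimately show ?thesis
    using infdist_le[OF p(2), of x] by (simp add: dist_norm norm_minus_commute)
qed

text \<open>The frontier point nearest to \<open>x\<close> cannot lie in the open ball, which is
  contained in the interior.\<close>

lemma interior_ball_infdist_ge:
  fixes \<Omega> :: "'a :: euclidean_space set"
  assumes "frontier \<Omega> \<noteq> {}" "ball w r \<subseteq> \<Omega>"
  shows "r - norm (x - w) \<le> infdist x (frontier \<Omega>)"
proof -
  obtain p where p: "p \<in> frontier \<Omega>" "infdist x (frontier \<Omega>) = dist x p"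
    using infdist_attains_inf[OF frontier_closed assms(1)] by blast
  have "ball w r \<subseteq> interior \<Omega>" using assms(2) by (simp add: interior_maximal)
  then have "p \<notin> ball w r" using p(1) by (auto simp: frontier_def)
  then have "r \<le> dist w p" by simp
  then show ?thesis
    using dist_triangle[of w p x] unfolding p(2) by (simp add: dist_norm norm_minus_commute)
qed

text \<open>\<open>w\<close> is the centre of the exterior ball at a boundary point nearest to
  \<open>y\<close>. For \<open>y\<close> near the boundary, |x - w| - r exceeds the boundary
  distance by at most a multiple of |x - y|^2; for \<open>y\<close> far away, the root of the
  distance satisfies a Lipschitz bound relative to \<open>y\<close>. The constants are uniform in
  \<open>y\<close>.\<close>

lemma sqrt_infdist_frontier_compare:
  fixes \<Omega> :: "'a :: euclidean_space set"
  assumes "closed \<Omega>" and "frontier \<Omega> \<noteq> {}" and "r > 0"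
    and balls: "\<And>z. z \<in> frontier \<Omega> \<Longrightarrow>
      \<exists>v. norm v = 1 \<and> ball (z + r *\<^sub>R v) r \<inter> \<Omega> = {} \<and> ball (z - r *\<^sub>R v) r \<subseteq> \<Omega>"
    and bounded: "\<And>x. x \<in> \<Omega> \<Longrightarrow> norm x \<le> B" and "y \<in> \<Omega>"
  shows "\<exists>w. (\<forall>x\<in>\<Omega>. r \<le> norm (x - w) \<and> norm (x - w) \<le> 2 * B + r) \<and>
    (\<forall>x\<in>\<Omega>. \<forall>\<eta>\<in>\<Omega>. \<bar>sqrt (infdist x (frontier \<Omega>)) - sqrt (infdist \<eta> (frontier \<Omega>))\<bar>
       \<le> 4 / sqrt r * (\<bar>sqrt ((norm (x - w))\<^sup>2 - r\<^sup>2) - sqrt ((norm (\<eta> - w))\<^sup>2 - r\<^sup>2)\<bar>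
           + norm (x - y) + norm (\<eta> - y)))"
proof -
  define d where "d x = infdist x (frontier \<Omega>)" for x
  have d_nonneg: "0 \<le> d x" for x by (simp add: d_def infdist_nonneg)
  obtain z where z: "z \<in> frontier \<Omega>" "d y = dist y z"
    unfolding d_def using infdist_attains_inf[OF frontier_closed assms(2)] by blast
  obtain v where v: "norm v = 1" "ball (z + r *\<^sub>R v) r \<inter> \<Omega> = {}" "ball (z - r *\<^sub>R v) r \<subseteq> \<Omega>"
    using balls[OF z(1)] by blast
  define w where "w = z + r *\<^sub>R v"
  define w' where "w' = z - r *\<^sub>R v"
  define s where "s x = norm (x - w) - r" for x
  have d_le_s: "d x \<le> s x" if "x \<in> \<Omega>" for x
    using exterior_ball_infdist_le[OF assms(1) v(2) assms(3) that] by (simp add: s_def d_def w_def)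
  have d_ge: "r - norm (x - w') \<le> d x" for x
    using interior_ball_infdist_ge[OF assms(2) v(3)] by (simp add: d_def w'_def)
  have zw: "norm (z - w) = r" using v(1) \<open>r > 0\<close> by (simp add: w_def)
  have near: "norm (x - w) \<le> 2 * B + r" if "x \<in> \<Omega>" for x
  proof -
    have "z \<in> \<Omega>" using z(1) assms(1) frontier_subset_closed by blast
    then have "norm (x - z) \<le> 2 * B"
      using bounded[of z] bounded[OF that] norm_triangle_ineq4[of x z] by linarith
    then show ?thesis using norm_triangle_ineq[of "x - z" "z - w"] zw by simp
  qed
  have u: "(norm (x - w))\<^sup>2 - r\<^sup>2 = (s x)\<^sup>2 + 2 * r * s x" for x
    by (simp add: s_def power2_eq_square algebra_simps)
  have sr: "sqrt r > 0" using \<open>r > 0\<close> by simp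
  have "\<bar>sqrt (d x) - sqrt (d \<eta>)\<bar>
      \<le> 4 / sqrt r * (\<bar>sqrt ((norm (x - w))\<^sup>2 - r\<^sup>2) - sqrt ((norm (\<eta> - w))\<^sup>2 - r\<^sup>2)\<bar>
          + norm (x - y) + norm (\<eta> - y))" if x: "x \<in> \<Omega>" and \<eta>: "\<eta> \<in> \<Omega>" for x \<eta>
  proof (cases "d y \<le> r / 4")
    case True
    have "norm (y - z) + r \<le> norm (y - w)"
      using d_le_s[OF \<open>y \<in> \<Omega>\<close>] z(2) by (simp add: s_def dist_norm)
    moreover have "norm (y - w) \<le> norm (y - z) + r"
      using norm_triangle_ineq[of "y - z" "z - w"] zw by simp
    \<comment> \<open>Equality in the triangle inequality forces the two vectors to be parallel, so
      \<open>y\<close> lies on the normal line through \<open>z\<close>, at depth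
      \<open>d y\<close>.\<close>
    ultimately have "norm ((y - z) + (z - w)) = norm (y - z) + norm (z - w)" using zw by simp
    then have "norm (y - z) *\<^sub>R (z - w) = r *\<^sub>R (y - z)"
      using zw norm_triangle_eq[of "y - z" "z - w"] by simp
    then have "r *\<^sub>R (y - z) = r *\<^sub>R (- d y *\<^sub>R v)" by (simp add: w_def z(2) dist_norm mult.commute)
    from scaleR_left_imp_eq[OF _ this] have yz: "y - z = - d y *\<^sub>R v" using \<open>r > 0\<close> by blast
    \<comment> \<open>\<open>y\<close> lies on the segment from \<open>w\<close> to \<open>w'\<close>, so the first-order terms of the two distances cancel.\<close>
    have sd: "s \<xi> - d \<xi> \<le> 2 / r * (norm (\<xi> - y))\<^sup>2" for \<xi>
    proof -
      let ?h = "\<xi> - y"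
      have a: "\<xi> - w = ?h + (r + d y) *\<^sub>R (- v)" and b: "\<xi> - w' = ?h + (r - d y) *\<^sub>R v"
        using yz by (auto simp: w_def w'_def algebra_simps)
      have "norm (\<xi> - w) \<le> (r + d y) + ?h \<bullet> (- v) + (norm ?h)\<^sup>2 / (2 * (r + d y))"
        unfolding a using v(1) \<open>r > 0\<close> d_nonneg[of y] by (intro norm_add_unit_le) auto
      moreover have "norm (\<xi> - w') \<le> (r - d y) + ?h \<bullet> v + (norm ?h)\<^sup>2 / (2 * (r - d y))"
        unfolding b using v(1) \<open>r > 0\<close> True by (intro norm_add_unit_le) auto
      moreover have "(norm ?h)\<^sup>2 / (2 * (r + d y)) \<le> (norm ?h)\<^sup>2 / r"
        using \<open>r > 0\<close> d_nonneg[of y] by (intro divide_left_mono mult_pos_pos) auto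
      moreover have "(norm ?h)\<^sup>2 / (2 * (r - d y)) \<le> (norm ?h)\<^sup>2 / r"
        using \<open>r > 0\<close> True by (intro divide_left_mono mult_pos_pos) auto
      ultimately have "norm (\<xi> - w) + norm (\<xi> - w') - 2 * r \<le> 2 * ((norm ?h)\<^sup>2 / r)"
        by (simp only: inner_minus_right)
      then show ?thesis using d_ge[of \<xi>] by (simp add: s_def)
    qed
    have first: "\<bar>sqrt (s \<xi>) - sqrt (d \<xi>)\<bar> \<le> 2 / sqrt r * norm (\<xi> - y)" if "\<xi> \<in> \<Omega>" for \<xi>
    proof -
      have "\<bar>sqrt (s \<xi>) - sqrt (d \<xi>)\<bar> \<le> sqrt (s \<xi> - d \<xi>)"
        by (rule sqrt_diff_le_sqrt_diff[OF d_nonneg d_le_s[OF that]])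
      also have "\<dots> \<le> sqrt (4 / r * (norm (\<xi> - y))\<^sup>2)"
      proof (rule real_sqrt_le_mono)
        have "2 / r * (norm (\<xi> - y))\<^sup>2 \<le> 4 / r * (norm (\<xi> - y))\<^sup>2"
          using \<open>r > 0\<close> by (intro mult_right_mono divide_right_mono) auto
        then show "s \<xi> - d \<xi> \<le> 4 / r * (norm (\<xi> - y))\<^sup>2" using sd[of \<xi>] by linarith
      qed
      also have "\<dots> = 2 / sqrt r * norm (\<xi> - y)"
        by (simp add: real_sqrt_mult real_sqrt_divide)
      finally show ?thesis .
    qed
    let ?U = "\<bar>sqrt ((norm (x - w))\<^sup>2 - r\<^sup>2) - sqrt ((norm (\<eta> - w))\<^sup>2 - r\<^sup>2)\<bar>"
    have "sqrt r * \<bar>sqrt (s x) - sqrt (s \<eta>)\<bar> \<le> sqrt (2 * r) * \<bar>sqrt (s x) - sqrt (s \<eta>)\<bar>"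
      using \<open>r > 0\<close> by (intro mult_right_mono) auto
    also have "\<dots> \<le> ?U"
      unfolding u using d_le_s[OF x] d_le_s[OF \<eta>] d_nonneg[of x] d_nonneg[of \<eta>] \<open>r > 0\<close>
      by (intro sqrt_diff_le_sqrt_square_diff) auto
    finally have "\<bar>sqrt (s x) - sqrt (s \<eta>)\<bar> \<le> ?U / sqrt r"
      using sr by (simp add: field_simps)
    then have "\<bar>sqrt (d x) - sqrt (d \<eta>)\<bar>
        \<le> ?U / sqrt r + 2 / sqrt r * norm (x - y) + 2 / sqrt r * norm (\<eta> - y)"
      using first[OF x] first[OF \<eta>] by linarith
    also have "\<dots> = 1 / sqrt r * (?U + 2 * norm (x - y) + 2 * norm (\<eta> - y))"
      by (simp add: algebra_simps)
    also have "\<dots> \<le> 1 / sqrt r * (4 * (?U + norm (x - y) + norm (\<eta> - y)))"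
      using sr norm_ge_zero[of "x - y"] norm_ge_zero[of "\<eta> - y"] by (intro mult_left_mono) auto
    finally show ?thesis by simp
  next
    case False
    \<comment> \<open>The difference of roots is the difference of distances divided by the sum of
      roots. That sum is at least sqrt(r)/2 here, and the distance function is 1-Lipschitz.\<close>
    have *: "\<bar>sqrt (d \<xi>) - sqrt (d y)\<bar> \<le> 2 / sqrt r * norm (\<xi> - y)" for \<xi>
    proof -
      have "sqrt r / 2 = sqrt (r / 4)" by (simp add: real_sqrt_divide)
      also have "\<dots> \<le> sqrt (d \<xi>) + sqrt (d y)"
        using False d_nonneg[of \<xi>] by (intro order_trans[OF real_sqrt_le_mono[of "r / 4" "d y"]]) auto
      also have "\<dots> \<le> \<bar>sqrt (d \<xi>) + sqrt (d y)\<bar>" by (rule abs_ge_self)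
      finally have "\<bar>sqrt (d \<xi>) - sqrt (d y)\<bar> * (sqrt r / 2)
          \<le> \<bar>sqrt (d \<xi>) - sqrt (d y)\<bar> * \<bar>sqrt (d \<xi>) + sqrt (d y)\<bar>"
        by (rule mult_left_mono) (rule abs_ge_zero)
      also have "\<dots> = \<bar>d \<xi> - d y\<bar>"
      proof -
        have "(sqrt (d \<xi>) - sqrt (d y)) * (sqrt (d \<xi>) + sqrt (d y)) = d \<xi> - d y"
          using d_nonneg[of \<xi>] d_nonneg[of y] by (simp add: algebra_simps)
        then show ?thesis by (simp only: abs_mult[symmetric])
      qed
      also have "\<dots> \<le> norm (\<xi> - y)"
        unfolding d_def dist_norm[symmetric] by (rule infdist_triangle_abs)
      finally show ?thesis using sr by (simp add: field_simps)
    qed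
    have "\<bar>sqrt (d x) - sqrt (d \<eta>)\<bar> \<le> 2 / sqrt r * (norm (x - y) + norm (\<eta> - y))"
      using *[of x] *[of \<eta>] by (simp add: distrib_left)
    also have "\<dots> \<le> 4 / sqrt r * (\<bar>sqrt ((norm (x - w))\<^sup>2 - r\<^sup>2) - sqrt ((norm (\<eta> - w))\<^sup>2 - r\<^sup>2)\<bar>
          + norm (x - y) + norm (\<eta> - y))"
      using sr by (intro mult_mono divide_right_mono) auto
    finally show ?thesis .
  qed
  moreover have "r \<le> norm (x - w)" if "x \<in> \<Omega>" for x
    using d_le_s[OF that] d_nonneg[of x] by (simp add: s_def)
  ultimately show ?thesis unfolding d_def using near by blast
qed

section \<open>Localized partitions of unity on the domain\<close>

lemma rho_nonneg: "0 \<le> rho \<Omega> x y"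
  by (simp add: rho_def)

lemma rho_same: "rho \<Omega> x x = 0"
  by (simp add: rho_def)

lemma rho_commute: "rho \<Omega> x y = rho \<Omega> y x"
  by (simp add: rho_def norm_minus_commute abs_minus_commute)

lemma rho_triangle: "rho \<Omega> x z \<le> rho \<Omega> x y + rho \<Omega> y z"
  unfolding rho_def using norm_triangle_ineq[of "x - y" "y - z"] by simp

lemma maximal_separated_subset:
  assumes "finite X" "\<epsilon> > 0"
  shows "\<exists>\<Lambda>\<subseteq>X. separated (rho \<Omega>) \<epsilon> \<Lambda> \<and> (\<forall>x\<in>X. \<exists>\<mu>\<in>\<Lambda>. rho \<Omega> x \<mu> < \<epsilon>)"
  using assms(1)
proof induction
  case empty
  show ?case by (auto simp: separated_def)
next
  case (insert y X)
  then obtain \<Lambda> where \<Lambda>: "\<Lambda> \<subseteq> X" "separated (rho \<Omega>) \<epsilon> \<Lambda>" "\<forall>x\<in>X. \<exists>\<mu>\<in>\<Lambda>. rho \<Omega> x \<mu> < \<epsilon>"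
    by blast
  show ?case
  proof (cases "\<exists>\<mu>\<in>\<Lambda>. rho \<Omega> y \<mu> < \<epsilon>")
    case True
    then show ?thesis using \<Lambda> by (intro exI[of _ \<Lambda>]) auto
  next
    case False
    then have "separated (rho \<Omega>) \<epsilon> (insert y \<Lambda>)"
      using \<Lambda>(2) unfolding separated_def by (metis insert_iff linorder_not_less rho_commute)
    then show ?thesis
      using \<Lambda> assms(2) by (intro exI[of _ "insert y \<Lambda>"]) (auto simp: rho_same)
  qed
qed

text \<open>Expanding the product yields the left side plus nonnegative terms. It converts an l1
  distance into a product of one-variable weights.\<close>

lemma one_plus_sum_le_prod:
  fixes a :: "'b \<Rightarrow> real"
  assumes "\<And>i. i \<in> A \<Longrightarrow> 0 \<le> a i"
  shows "1 + (\<Sum>i\<in>A. a i) \<le> (\<Prod>i\<in>A. 1 + a i)"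
  using assms
proof (induction A rule: infinite_finite_induct)
  case (insert j A)
  have "1 + (\<Sum>i\<in>insert j A. a i) \<le> (1 + a j) * (1 + (\<Sum>i\<in>A. a i))"
    using insert by (simp add: distrib_right distrib_left sum_nonneg)
  also have "\<dots> \<le> (1 + a j) * (\<Prod>i\<in>A. 1 + a i)"
    using insert by (intro mult_left_mono insert.IH) auto
  finally show ?case using insert by simp
qed auto

text \<open>Each centre is attached to a net point within 1/n, which changes the weight by at most a
  factor 2. A regrouped piece is then bounded by the whole weighted sum, however many centres it
  collects.\<close>

lemma regroup_partition:
  fixes \<Omega> :: "'a :: euclidean_space set" and Q :: "'b \<Rightarrow> 'a \<Rightarrow> real"
  assumes "finite I" "n \<ge> 1" and \<eta>: "\<And>i. i \<in> I \<Longrightarrow> \<eta> i \<in> \<Omega>"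
    and Q_poly: "\<And>i. i \<in> I \<Longrightarrow> Q i \<in> poly_space s"
    and Q_nonneg: "\<And>i x. i \<in> I \<Longrightarrow> x \<in> \<Omega> \<Longrightarrow> 0 \<le> Q i x"
    and Q_sum: "\<And>x. x \<in> \<Omega> \<Longrightarrow> (\<Sum>i\<in>I. Q i x) = 1"
    and Q_moment: "\<And>x. x \<in> \<Omega> \<Longrightarrow> (\<Sum>i\<in>I. Q i x * (1 + real n * rho \<Omega> x (\<eta> i)) ^ k) \<le> C"
  shows "\<exists>\<Lambda> P. finite \<Lambda> \<and> \<Lambda> \<subseteq> \<Omega> \<and> separated (rho \<Omega>) (1 / real n) \<Lambda> \<and>
    (\<forall>\<mu>\<in>\<Lambda>. P \<mu> \<in> poly_space s) \<and>
    (\<forall>x\<in>\<Omega>. (\<Sum>\<mu>\<in>\<Lambda>. P \<mu> x) = 1 \<and>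
      (\<forall>\<mu>\<in>\<Lambda>. \<bar>P \<mu> x\<bar> * (1 + real n * rho \<Omega> x \<mu>) ^ k \<le> 2 ^ k * C))"
proof -
  have n: "1 / real n > 0" using assms(2) by simp
  obtain \<Lambda> where \<Lambda>: "\<Lambda> \<subseteq> \<eta> ` I" "separated (rho \<Omega>) (1 / real n) \<Lambda>"
    "\<forall>x\<in>\<eta> ` I. \<exists>\<mu>\<in>\<Lambda>. rho \<Omega> x \<mu> < 1 / real n"
    using maximal_separated_subset[OF finite_imageI[OF assms(1)] n] by blast
  have "\<forall>i\<in>I. \<exists>\<mu>. \<mu> \<in> \<Lambda> \<and> rho \<Omega> (\<eta> i) \<mu> < 1 / real n" using \<Lambda>(3) by blast
  then obtain a where a: "\<And>i. i \<in> I \<Longrightarrow> a i \<in> \<Lambda>" "\<And>i. i \<in> I \<Longrightarrow> rho \<Omega> (\<eta> i) (a i) < 1 / real n"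
    by metis
  define P where "P \<mu> x = (\<Sum>i\<in>{i\<in>I. a i = \<mu>}. Q i x)" for \<mu> x
  have fin: "finite \<Lambda>" using \<Lambda>(1) assms(1) finite_subset by blast
  have "\<Lambda> \<subseteq> \<Omega>" using \<Lambda>(1) \<eta> by blast
  moreover have "P \<mu> \<in> poly_space s" for \<mu>
    unfolding P_def[abs_def] by (intro poly_space_sum Q_poly) simp
  moreover have "(\<Sum>\<mu>\<in>\<Lambda>. P \<mu> x) = 1" if "x \<in> \<Omega>" for x
    unfolding P_def using sum.group[OF assms(1) fin, of a "\<lambda>i. Q i x"] a(1) Q_sum[OF that] by auto
  moreover have "\<bar>P \<mu> x\<bar> * (1 + real n * rho \<Omega> x \<mu>) ^ k \<le> 2 ^ k * C" if x: "x \<in> \<Omega>" for \<mu> x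
  proof -
    have "0 \<le> P \<mu> x" unfolding P_def by (intro sum_nonneg Q_nonneg x) simp
    then have "\<bar>P \<mu> x\<bar> * (1 + real n * rho \<Omega> x \<mu>) ^ k
        = (\<Sum>i\<in>{i\<in>I. a i = \<mu>}. Q i x * (1 + real n * rho \<Omega> x \<mu>) ^ k)"
      by (simp add: P_def sum_distrib_right)
    also have "\<dots> \<le> (\<Sum>i\<in>{i\<in>I. a i = \<mu>}. 2 ^ k * (Q i x * (1 + real n * rho \<Omega> x (\<eta> i)) ^ k))"
    proof (intro sum_mono)
      fix i assume i: "i \<in> {i\<in>I. a i = \<mu>}"
      have nonneg: "0 \<le> real n * rho \<Omega> x (\<eta> i)"
        by (intro mult_nonneg_nonneg rho_nonneg) simp
      have "rho \<Omega> x \<mu> \<le> rho \<Omega> x (\<eta> i) + 1 / real n"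
        using rho_triangle[of \<Omega> x \<mu> "\<eta> i"] a(2)[of i] i by auto
      then have "real n * rho \<Omega> x \<mu> \<le> real n * (rho \<Omega> x (\<eta> i) + 1 / real n)"
        by (rule mult_left_mono) simp
      also have "\<dots> = real n * rho \<Omega> x (\<eta> i) + 1" using assms(2) by (simp add: distrib_left)
      finally have "1 + real n * rho \<Omega> x \<mu> \<le> 2 * (1 + real n * rho \<Omega> x (\<eta> i))"
        using nonneg unfolding mult_2 by linarith
      then have "(1 + real n * rho \<Omega> x \<mu>) ^ k \<le> (2 * (1 + real n * rho \<Omega> x (\<eta> i))) ^ k"
        by (intro power_mono) (simp_all add: rho_nonneg)
      then have "Q i x * (1 + real n * rho \<Omega> x \<mu>) ^ k \<le> Q i x * (2 * (1 + real n * rho \<Omega> x (\<eta> i))) ^ k"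
        using Q_nonneg[of i x] i x by (intro mult_left_mono) auto
      then show "Q i x * (1 + real n * rho \<Omega> x \<mu>) ^ k
          \<le> 2 ^ k * (Q i x * (1 + real n * rho \<Omega> x (\<eta> i)) ^ k)"
        unfolding power_mult_distrib by (simp only: mult.left_commute)
    qed
    also have "\<dots> \<le> (\<Sum>i\<in>I. 2 ^ k * (Q i x * (1 + real n * rho \<Omega> x (\<eta> i)) ^ k))"
      using assms(1) x by (intro sum_mono2) (auto intro!: mult_nonneg_nonneg Q_nonneg simp: rho_nonneg)
    also have "\<dots> \<le> 2 ^ k * C"
      using Q_moment[OF x] by (simp add: sum_distrib_left[symmetric])
    finally show ?thesis .
  qed
  ultimately show ?thesis using fin \<Lambda>(2) by (intro exI[of _ \<Lambda>] exI[of _ P]) blast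
qed

section \<open>Tensor products combined with a radial factor\<close>

text \<open>An index (k, i) combines a multi-index \<open>k\<close> of coordinate pieces with a
  piece \<open>i\<close> in the radial variable of the ball chosen for \<open>k\<close>. The weight
  is dominated by a product of one-variable weights, so the moment bound factors.\<close>

lemma localized_partition_domain:
  fixes \<Omega> :: "'a :: euclidean_space set"
  assumes "compact \<Omega>" "\<Omega> \<noteq> {}" "n \<ge> 1" "B \<ge> 1" "R > 0" "C \<ge> 0"
    and bounded: "\<And>x. x \<in> \<Omega> \<Longrightarrow> norm x \<le> B"
    and quadric: "\<And>y. y \<in> \<Omega> \<Longrightarrow> \<exists>w. (\<forall>x\<in>\<Omega>. r \<le> norm (x - w) \<and> norm (x - w) \<le> R) \<and>
    (\<forall>x\<in>\<Omega>. \<forall>\<eta>\<in>\<Omega>. \<bar>sqrt (infdist x (frontier \<Omega>)) - sqrt (infdist \<eta> (frontier \<Omega>))\<bar>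
       \<le> C * (\<bar>sqrt ((norm (x - w))\<^sup>2 - r\<^sup>2) - sqrt ((norm (\<eta> - w))\<^sup>2 - r\<^sup>2)\<bar>
           + norm (x - y) + norm (\<eta> - y)))"
    and "r \<ge> 0"
  shows "\<exists>(I :: (('a \<Rightarrow> nat) \<times> nat) set) \<eta> Q. finite I \<and> (\<forall>i\<in>I. \<eta> i \<in> \<Omega>) \<and>
    (\<forall>i\<in>I. Q i \<in> poly_space ((DIM('a) + 2) * Suc K * n)) \<and>
    (\<forall>i\<in>I. \<forall>x\<in>\<Omega>. 0 \<le> Q i x) \<and>
    (\<forall>x\<in>\<Omega>. (\<Sum>i\<in>I. Q i x) = 1 \<and>
      (\<Sum>i\<in>I. Q i x * (1 + real n * rho \<Omega> x (\<eta> i)) ^ (2 * K))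
        \<le> ((2 + C * (2 * R + 4)) * B) ^ (2 * K) * (9 ^ K * Suc K) ^ Suc DIM('a))"
proof -
  define S :: real where "S = 9 ^ K * Suc K"
  obtain N :: nat and t :: "nat \<Rightarrow> real" and p :: "nat \<Rightarrow> real poly" where
    p: "\<And>k. degree (p k) \<le> Suc K * n"
    "\<And>k x. \<bar>x\<bar> \<le> 1 \<Longrightarrow> 0 \<le> poly (p k) x"
    "\<And>x. \<bar>x\<bar> \<le> 1 \<Longrightarrow> (\<Sum>k<N. poly (p k) x) = 1"
    "\<And>x. \<bar>x\<bar> \<le> 1 \<Longrightarrow>
       (\<Sum>k<N. poly (p k) x * (1 + real n * \<bar>x - t k\<bar>) ^ (2 * K)) \<le> 9 ^ K * Suc K"
    by (rule localized_partition_cos[OF assms(3), where K = K]) (rule that)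
  obtain N' :: nat and t' :: "nat \<Rightarrow> real" and q :: "nat \<Rightarrow> real poly" where
    q: "\<And>k. degree (q k) \<le> Suc K * n"
    "\<And>k u. 0 \<le> u \<Longrightarrow> u \<le> 1 \<Longrightarrow> 0 \<le> poly (q k) (u\<^sup>2)"
    "\<And>u. 0 \<le> u \<Longrightarrow> u \<le> 1 \<Longrightarrow> (\<Sum>k<N'. poly (q k) (u\<^sup>2)) = 1"
    "\<And>u. 0 \<le> u \<Longrightarrow> u \<le> 1 \<Longrightarrow>
       (\<Sum>k<N'. poly (q k) (u\<^sup>2) * (1 + real n * \<bar>u - t' k\<bar>) ^ (2 * K)) \<le> 9 ^ K * Suc K"
    by (rule localized_partition_sqrt[OF assms(3), where K = K]) (rule that)
  define y :: "('a \<Rightarrow> nat) \<Rightarrow> 'a" where "y k = (\<Sum>b\<in>Basis. (B * t (k b)) *\<^sub>R b)" for k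
  have y_inner: "y k \<bullet> b = B * t (k b)" if "b \<in> Basis" for k b
    using that by (simp add: y_def)
  have "\<exists>w. (\<forall>x\<in>\<Omega>. r \<le> norm (x - w) \<and> norm (x - w) \<le> R) \<and>
    (\<forall>x\<in>\<Omega>. \<forall>\<eta>\<in>\<Omega>. \<bar>sqrt (infdist x (frontier \<Omega>)) - sqrt (infdist \<eta> (frontier \<Omega>))\<bar>
       \<le> C * (\<bar>sqrt ((norm (x - w))\<^sup>2 - r\<^sup>2) - sqrt ((norm (\<eta> - w))\<^sup>2 - r\<^sup>2)\<bar>
           + 2 * norm (x - y k) + 2 * norm (\<eta> - y k)))" for k
  proof -
    \<comment> \<open>The grid centre \<open>y k\<close> may lie outside \<Omega>; its nearest point
      in \<Omega> replaces it at the cost of doubling distances to points of \<Omega>.\<close>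
    obtain y' where y': "y' \<in> \<Omega>" "infdist (y k) \<Omega> = dist (y k) y'"
      using infdist_attains_inf[OF compact_imp_closed[OF assms(1)] assms(2)] by blast
    have near: "norm (x - y') \<le> 2 * norm (x - y k)" if "x \<in> \<Omega>" for x
      using infdist_le[OF that, of "y k"] dist_triangle[of x y' "y k"]
      unfolding y'(2) by (simp add: dist_norm norm_minus_commute)
    obtain w where w: "\<forall>x\<in>\<Omega>. r \<le> norm (x - w) \<and> norm (x - w) \<le> R"
      "\<forall>x\<in>\<Omega>. \<forall>\<eta>\<in>\<Omega>. \<bar>sqrt (infdist x (frontier \<Omega>)) - sqrt (infdist \<eta> (frontier \<Omega>))\<bar>
       \<le> C * (\<bar>sqrt ((norm (x - w))\<^sup>2 - r\<^sup>2) - sqrt ((norm (\<eta> - w))\<^sup>2 - r\<^sup>2)\<bar>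
           + norm (x - y') + norm (\<eta> - y'))"
      using quadric[OF y'(1)] by blast
    show ?thesis
    proof (intro exI[of _ w] conjI w(1) ballI)
      fix x \<eta> assume x: "x \<in> \<Omega>" and \<eta>: "\<eta> \<in> \<Omega>"
      show "\<bar>sqrt (infdist x (frontier \<Omega>)) - sqrt (infdist \<eta> (frontier \<Omega>))\<bar>
       \<le> C * (\<bar>sqrt ((norm (x - w))\<^sup>2 - r\<^sup>2) - sqrt ((norm (\<eta> - w))\<^sup>2 - r\<^sup>2)\<bar>
           + 2 * norm (x - y k) + 2 * norm (\<eta> - y k))"
        using near[OF x] near[OF \<eta>] \<open>C \<ge> 0\<close>
        by (intro order_trans[OF w(2)[rule_format, OF x \<eta>]] mult_left_mono add_mono) auto
    qed
  qed
  then have "\<forall>k. \<exists>w. (\<forall>x\<in>\<Omega>. r \<le> norm (x - w) \<and> norm (x - w) \<le> R) \<and>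
    (\<forall>x\<in>\<Omega>. \<forall>\<eta>\<in>\<Omega>. \<bar>sqrt (infdist x (frontier \<Omega>)) - sqrt (infdist \<eta> (frontier \<Omega>))\<bar>
       \<le> C * (\<bar>sqrt ((norm (x - w))\<^sup>2 - r\<^sup>2) - sqrt ((norm (\<eta> - w))\<^sup>2 - r\<^sup>2)\<bar>
           + 2 * norm (x - y k) + 2 * norm (\<eta> - y k)))" by (rule allI)
  from choice[OF this] obtain w where w: "\<And>k x. x \<in> \<Omega> \<Longrightarrow> r \<le> norm (x - w k)"
    "\<And>k x. x \<in> \<Omega> \<Longrightarrow> norm (x - w k) \<le> R"
    "\<And>k x \<eta>. x \<in> \<Omega> \<Longrightarrow> \<eta> \<in> \<Omega> \<Longrightarrow>
       \<bar>sqrt (infdist x (frontier \<Omega>)) - sqrt (infdist \<eta> (frontier \<Omega>))\<bar>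
       \<le> C * (\<bar>sqrt ((norm (x - w k))\<^sup>2 - r\<^sup>2) - sqrt ((norm (\<eta> - w k))\<^sup>2 - r\<^sup>2)\<bar>
           + 2 * norm (x - y k) + 2 * norm (\<eta> - y k))"
    by blast
  \<comment> \<open>Division by \<open>R\<close> brings the radial variable into [0, 1], the range
    of the even partition; its square is a quadratic polynomial on \<Omega>.\<close>
  define u where "u k x = sqrt ((norm (x - w k))\<^sup>2 - r\<^sup>2) / R" for k x
  have u_square: "(u k x)\<^sup>2 = ((norm (x - w k))\<^sup>2 - r\<^sup>2) / R\<^sup>2" if "x \<in> \<Omega>" for k x
    using w(1)[OF that, of k] \<open>r \<ge> 0\<close> by (simp add: u_def power_divide power_mono)
  have u_nonneg: "0 \<le> u k x" if "x \<in> \<Omega>" for k x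
    using w(1)[OF that, of k] \<open>r \<ge> 0\<close> \<open>R > 0\<close> by (simp add: u_def power_mono)
  have u_le: "u k x \<le> 1" if "x \<in> \<Omega>" for k x
  proof -
    have "(norm (x - w k))\<^sup>2 \<le> R\<^sup>2" using w(2)[OF that] by (intro power_mono) auto
    then have "(norm (x - w k))\<^sup>2 - r\<^sup>2 \<le> R\<^sup>2" using zero_le_power2[of r] by linarith
    then have "sqrt ((norm (x - w k))\<^sup>2 - r\<^sup>2) \<le> sqrt (R\<^sup>2)" by (rule real_sqrt_le_mono)
    then show ?thesis using \<open>R > 0\<close> by (simp add: u_def)
  qed
  \<comment> \<open>The value \<open>e k i x\<close> measures how far \<open>x\<close> is from
    matching the nominal data \<open>y k\<close> and \<open>t' i\<close>. No point of \<Omega> need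
    match them, so the actual centre is a minimizer of \<open>e\<close> on the compact set
    \<Omega>.\<close>
  define e where "e k i x = norm (x - y k) + \<bar>u k x - t' i\<bar>" for k i x
  have "\<exists>\<eta>\<in>\<Omega>. \<forall>x\<in>\<Omega>. e k i \<eta> \<le> e k i x" for k i
    unfolding e_def u_def using \<open>R > 0\<close>
    by (intro continuous_attains_inf[OF assms(1,2)] continuous_intros) auto
  then have "\<forall>j. \<exists>\<eta>. \<eta> \<in> \<Omega> \<and> (\<forall>x\<in>\<Omega>. e (fst j) (snd j) \<eta> \<le> e (fst j) (snd j) x)" by blast
  from choice[OF this] obtain \<eta> where \<eta>: "\<And>j. \<eta> j \<in> \<Omega>"
    "\<And>j x. x \<in> \<Omega> \<Longrightarrow> e (fst j) (snd j) (\<eta> j) \<le> e (fst j) (snd j) x"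
    by blast
  \<comment> \<open>By minimality the discrepancy of the centre is at most that of \<open>x\<close>.
    The first 2 in the constant comes from the Euclidean part, 2R from undoing the scaling of
    \<open>u\<close>, and 4 from the two error terms.\<close>
  have rho_le: "rho \<Omega> x (\<eta> (k, i)) \<le> (2 + C * (2 * R + 4)) * e k i x" if x: "x \<in> \<Omega>" for x k i
  proof -
    let ?\<eta> = "\<eta> (k, i)"
    have parts: "norm (\<xi> - y k) \<le> e k i \<xi>" "\<bar>u k \<xi> - t' i\<bar> \<le> e k i \<xi>" for \<xi>
      by (simp_all add: e_def)
    have e: "e k i ?\<eta> \<le> e k i x" using \<eta>(2)[OF x, of "(k, i)"] by simp
    have "norm (x - ?\<eta>) \<le> norm (x - y k) + norm (?\<eta> - y k)"
      using norm_triangle_ineq4[of "x - y k" "?\<eta> - y k"] by simp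
    then have 1: "norm (x - ?\<eta>) \<le> 2 * e k i x" using e parts[of x] parts[of ?\<eta>] by linarith
    have "\<bar>u k x - u k ?\<eta>\<bar> \<le> 2 * e k i x" using e parts[of x] parts[of ?\<eta>] by linarith
    then have "R * \<bar>u k x - u k ?\<eta>\<bar> \<le> R * (2 * e k i x)"
      using \<open>R > 0\<close> by (intro mult_left_mono) auto
    then have "\<bar>sqrt ((norm (x - w k))\<^sup>2 - r\<^sup>2) - sqrt ((norm (?\<eta> - w k))\<^sup>2 - r\<^sup>2)\<bar> \<le> 2 * R * e k i x"
      using \<open>R > 0\<close> unfolding u_def diff_divide_distrib[symmetric] by (simp add: abs_divide)
    moreover have "norm (x - y k) \<le> e k i x" "norm (?\<eta> - y k) \<le> e k i x"
      using e parts[of x] parts[of ?\<eta>] by linarith+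
    ultimately have "\<bar>sqrt (infdist x (frontier \<Omega>)) - sqrt (infdist ?\<eta> (frontier \<Omega>))\<bar>
        \<le> C * (2 * R * e k i x + 2 * e k i x + 2 * e k i x)"
      using \<open>C \<ge> 0\<close>
      by (intro order_trans[OF w(3)[OF x \<eta>(1)]] mult_left_mono add_mono) auto
    then show ?thesis using 1 unfolding rho_def by (simp add: algebra_simps)
  qed
  define D where "D = 2 + C * (2 * R + 4)"
  have D: "D \<ge> 1" using \<open>C \<ge> 0\<close> \<open>R > 0\<close> by (simp add: D_def)
  have coord: "\<bar>x \<bullet> b / B\<bar> \<le> 1" if "x \<in> \<Omega>" "b \<in> Basis" for x b
    using Basis_le_norm[OF that(2), of x] bounded[OF that(1)] \<open>B \<ge> 1\<close> by (simp add: abs_divide)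
  define f where "f x b k = 1 + real n * \<bar>x \<bullet> b / B - t k\<bar>" for x :: 'a and b k
  define g where "g k x i = 1 + real n * \<bar>u k x - t' i\<bar>" for k x i
  have f1: "1 \<le> f x b m" for x b m by (simp add: f_def)
  have g1: "1 \<le> g k x i" for k x i by (simp add: g_def)
  have weight: "1 + real n * rho \<Omega> x (\<eta> (k, i)) \<le> D * B * ((\<Prod>b\<in>Basis. f x b (k b)) * g k x i)"
    if x: "x \<in> \<Omega>" for x k i
  proof -
    have "norm (x - y k) \<le> (\<Sum>b\<in>Basis. \<bar>(x - y k) \<bullet> b\<bar>)" by (rule norm_le_l1)
    also have "\<dots> = (\<Sum>b\<in>Basis. B * \<bar>x \<bullet> b / B - t (k b)\<bar>)"
    proof (rule sum.cong)
      fix b :: 'a assume "b \<in> Basis"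
      then have "(x - y k) \<bullet> b = B * (x \<bullet> b / B - t (k b))"
        using \<open>B \<ge> 1\<close> by (simp add: inner_diff_left y_inner right_diff_distrib)
      then show "\<bar>(x - y k) \<bullet> b\<bar> = B * \<bar>x \<bullet> b / B - t (k b)\<bar>" using \<open>B \<ge> 1\<close> by (simp add: abs_mult)
    qed simp
    finally have "real n * norm (x - y k) \<le> real n * (\<Sum>b\<in>Basis. B * \<bar>x \<bullet> b / B - t (k b)\<bar>)"
      by (rule mult_left_mono) simp
    also have "\<dots> = B * (\<Sum>b\<in>Basis. real n * \<bar>x \<bullet> b / B - t (k b)\<bar>)"
      by (simp add: sum_distrib_left mult.left_commute)
    also have "\<dots> \<le> B * ((\<Prod>b\<in>Basis. f x b (k b)) - 1)"
      using one_plus_sum_le_prod[of Basis "\<lambda>b. real n * \<bar>x \<bullet> b / B - t (k b)\<bar>"] \<open>B \<ge> 1\<close>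
      by (intro mult_left_mono) (auto simp: f_def)
    finally have 1: "real n * norm (x - y k) \<le> B * ((\<Prod>b\<in>Basis. f x b (k b)) - 1)" .
    let ?F = "\<Prod>b\<in>Basis. f x b (k b)"
    have F1: "1 \<le> ?F" by (intro prod_ge_1 f1)
    have "1 + real n * e k i x \<le> 1 + B * (?F - 1) + (g k x i - 1)"
      using 1 by (simp add: e_def g_def distrib_left)
    also have "\<dots> \<le> B + B * (?F - 1) + B * (?F * (g k x i - 1))"
    proof -
      \<comment> \<open>Since B and the product are at least 1, the additive radial term can be made
        a multiple of both, after which the sum telescopes to a product.\<close>
      have "1 * (g k x i - 1) \<le> (B * ?F) * (g k x i - 1)"
        using mult_mono[OF \<open>B \<ge> 1\<close> F1] \<open>B \<ge> 1\<close> g1[of k x i] by (intro mult_right_mono) auto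
      then show ?thesis using \<open>B \<ge> 1\<close> by (simp add: mult.assoc)
    qed
    also have "\<dots> = B * (?F * g k x i)" by (simp add: algebra_simps)
    finally have 2: "1 + real n * e k i x \<le> B * (?F * g k x i)" .
    have "1 + real n * rho \<Omega> x (\<eta> (k, i)) \<le> D + real n * (D * e k i x)"
      using rho_le[OF x, of k i] D unfolding D_def[symmetric] by (intro add_mono mult_left_mono) auto
    also have "\<dots> = D * (1 + real n * e k i x)" by (simp add: algebra_simps)
    also have "\<dots> \<le> D * (B * (?F * g k x i))" using 2 D by (intro mult_left_mono) auto
    finally show ?thesis by (simp add: mult.assoc)
  qed
  define I where "I = ((Basis :: 'a set) \<rightarrow>\<^sub>E {..<N}) \<times> {..<N'}"
  define Q where "Q j x = (\<Prod>b\<in>Basis. poly (p (fst j b)) (x \<bullet> b / B))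
      * poly (q (snd j)) (((norm (x - w (fst j)))\<^sup>2 - r\<^sup>2) / R\<^sup>2)" for j and x :: 'a
  have finK: "finite ((Basis :: 'a set) \<rightarrow>\<^sub>E {..<N})" by (intro finite_PiE) auto
  then have fin: "finite I" by (simp add: I_def)
  have Q_eq: "Q (k, i) x = (\<Prod>b\<in>Basis. poly (p (k b)) (x \<bullet> b / B)) * poly (q i) ((u k x)\<^sup>2)"
    if "x \<in> \<Omega>" for k i x by (simp add: Q_def u_square[OF that])
  have prod_nonneg': "0 \<le> (\<Prod>b\<in>Basis. poly (p (k b)) (x \<bullet> b / B))" if "x \<in> \<Omega>" for k x
    using coord[OF that] by (intro prod_nonneg p(2)) auto
  have Q_nonneg: "0 \<le> Q j x" if "x \<in> \<Omega>" for j x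
    using Q_eq[OF that, of "fst j" "snd j"] prod_nonneg'[OF that] q(2)[OF u_nonneg[OF that] u_le[OF that]]
    by simp
  have Q_sum: "(\<Sum>j\<in>I. Q j x) = 1" if x: "x \<in> \<Omega>" for x
  proof -
    have "(\<Sum>j\<in>I. Q j x) = (\<Sum>k\<in>Basis \<rightarrow>\<^sub>E {..<N}. \<Sum>i<N'. Q (k, i) x)"
      unfolding I_def by (simp add: sum.cartesian_product)
    also have "\<dots> = (\<Sum>k\<in>Basis \<rightarrow>\<^sub>E {..<N}. \<Prod>b\<in>Basis. poly (p (k b)) (x \<bullet> b / B))"
      by (intro sum.cong refl)
        (simp add: Q_eq[OF x] sum_distrib_left[symmetric] q(3)[OF u_nonneg[OF x] u_le[OF x]])
    also have "\<dots> = (\<Prod>b\<in>Basis. \<Sum>m<N. poly (p m) (x \<bullet> b / B))"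
      by (rule prod_sum_PiE[symmetric]) auto
    also have "\<dots> = 1" using coord[OF x] by (intro prod.neutral ballI p(3)) auto
    finally show ?thesis .
  qed
  have Q_moment: "(\<Sum>j\<in>I. Q j x * (1 + real n * rho \<Omega> x (\<eta> j)) ^ (2 * K)) \<le> (D * B) ^ (2 * K) * S ^ Suc DIM('a)"
    if x: "x \<in> \<Omega>" for x
  proof -
    have S: "S \<ge> 0" by (simp add: S_def)
    have "(\<Sum>j\<in>I. Q j x * (1 + real n * rho \<Omega> x (\<eta> j)) ^ (2 * K))
        \<le> (\<Sum>(k, i)\<in>I. Q (k, i) x * (D * B * ((\<Prod>b\<in>Basis. f x b (k b)) * g k x i)) ^ (2 * K))"
    proof (intro sum_mono)
      fix j assume "j \<in> I"
      obtain k i where j: "j = (k, i)" by (cases j)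
      show "Q j x * (1 + real n * rho \<Omega> x (\<eta> j)) ^ (2 * K)
          \<le> (case j of (k, i) \<Rightarrow> Q (k, i) x * (D * B * ((\<Prod>b\<in>Basis. f x b (k b)) * g k x i)) ^ (2 * K))"
        unfolding j prod.case
        using weight[OF x] Q_nonneg[OF x] by (intro mult_left_mono power_mono) (auto simp: rho_nonneg)
    qed
    \<comment> \<open>The radial variable depends on \<open>k\<close>, so the inner sum over
      \<open>i\<close> is bounded first, uniformly in \<open>k\<close>; only then does the sum over
      \<open>k\<close> split into coordinate factors.\<close>
    also have "\<dots> = (D * B) ^ (2 * K) * (\<Sum>k\<in>Basis \<rightarrow>\<^sub>E {..<N}.
        (\<Prod>b\<in>Basis. poly (p (k b)) (x \<bullet> b / B) * f x b (k b) ^ (2 * K)) *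
        (\<Sum>i<N'. poly (q i) ((u k x)\<^sup>2) * g k x i ^ (2 * K)))"
      unfolding I_def sum.cartesian_product[symmetric] sum_distrib_left
      by (intro sum.cong refl)
        (simp add: Q_eq[OF x] power_mult_distrib prod.distrib prod_power_distrib mult_ac)
    also have "\<dots> \<le> (D * B) ^ (2 * K) * (\<Sum>k\<in>Basis \<rightarrow>\<^sub>E {..<N}.
        (\<Prod>b\<in>Basis. poly (p (k b)) (x \<bullet> b / B) * f x b (k b) ^ (2 * K)) * S)"
    proof (intro mult_left_mono sum_mono)
      fix k
      show "(\<Sum>i<N'. poly (q i) ((u k x)\<^sup>2) * g k x i ^ (2 * K)) \<le> S"
        using q(4)[OF u_nonneg[OF x] u_le[OF x]] by (simp add: g_def S_def)
      show "0 \<le> (\<Prod>b\<in>Basis. poly (p (k b)) (x \<bullet> b / B) * f x b (k b) ^ (2 * K))"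
        using coord[OF x] by (intro prod_nonneg mult_nonneg_nonneg p(2)) (auto simp: f_def)
    qed (use D \<open>B \<ge> 1\<close> in auto)
    also have "\<dots> = (D * B) ^ (2 * K) * (S * (\<Prod>b\<in>Basis. \<Sum>m<N. poly (p m) (x \<bullet> b / B) * f x b m ^ (2 * K)))"
      by (subst prod_sum_PiE) (auto simp: sum_distrib_left mult.commute)
    also have "\<dots> \<le> (D * B) ^ (2 * K) * (S * (\<Prod>b\<in>(Basis :: 'a set). S))"
      using coord[OF x] p(4) S D \<open>B \<ge> 1\<close>
      by (intro mult_left_mono prod_mono conjI sum_nonneg mult_nonneg_nonneg p(2))
        (auto simp: f_def S_def)
    finally show ?thesis by simp
  qed
  have Q_poly: "Q j \<in> poly_space ((DIM('a) + 2) * Suc K * n)" for j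
  proof -
    have 1: "(\<lambda>x. poly (p (fst j b)) (x \<bullet> b / B)) \<in> poly_space (Suc K * n)" for b :: 'a
    proof (rule poly_space_poly)
      show "(\<lambda>x. x \<bullet> b / B) \<in> poly_space 1"
        using poly_space_cmult[OF poly_space_inner, of "1 / B" b] by simp
    qed (use p(1) in simp)
    have "(\<lambda>x :: 'a. 1 / R\<^sup>2 * ((norm (x - w (fst j)))\<^sup>2 + - (r\<^sup>2))) \<in> poly_space 2"
      by (intro poly_space_cmult poly_space_add poly_space_norm_diff_squared poly_space_const)
    then have 2: "(\<lambda>x :: 'a. ((norm (x - w (fst j)))\<^sup>2 - r\<^sup>2) / R\<^sup>2) \<in> poly_space 2" by simp
    \<comment> \<open>The radial argument is quadratic, so its factor counts twice; together with
      one factor per coordinate this gives \<open>DIM('a) + 2\<close>.\<close>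
    have "degree (q (snd j)) * 2 \<le> Suc K * n * 2" by (intro mult_right_mono q(1)) simp
    from poly_space_mult[OF poly_space_prod[of Basis, OF 1] poly_space_poly[OF 2 this]]
    show ?thesis unfolding Q_def[abs_def] by (simp only: distrib_right mult.assoc mult.commute[of _ 2] mult_2)
  qed
  show ?thesis
    using fin \<eta>(1) Q_poly Q_nonneg Q_sum Q_moment unfolding D_def S_def
    by (intro exI[of _ I] exI[of _ \<eta>] exI[of _ Q]) simp
qed

section \<open>Choice of the constants and conversion to a decay estimate\<close>

theorem theorem1p12:
  fixes \<Omega> \<Omega>\<^sub>0 :: "((real ^ 'd) \<times> real) set" and l :: real
  assumes "C2_domain \<Omega>\<^sub>0" and "\<Omega> = closure \<Omega>\<^sub>0" and "l > 1"
  shows "\<exists>(c\<^sub>0 :: nat) (C\<^sub>1 :: real). c\<^sub>0 > 0 \<and> C\<^sub>1 > 0 \<and>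
    (\<forall>n :: nat. n \<ge> 1 \<longrightarrow>
      (\<exists>(m :: nat) (\<xi> :: nat \<Rightarrow> (real ^ 'd) \<times> real) (P :: nat \<Rightarrow> (real ^ 'd) \<times> real \<Rightarrow> real).
         inj_on \<xi> {1..m} \<and> \<xi> ` {1..m} \<subseteq> \<Omega> \<and>
         separated (rho \<Omega>) (1 / real n) (\<xi> ` {1..m}) \<and>
         (\<forall>j\<in>{1..m}. P j \<in> poly_space (c\<^sub>0 * n)) \<and>
         (\<forall>x\<in>\<Omega>. (\<Sum>j=1..m. P j x) = 1 \<and>
            (\<forall>j\<in>{1..m}. \<bar>P j x\<bar> \<le> C\<^sub>1 * (1 + real n * rho \<Omega> x (\<xi> j)) powr (- l)))))"
proof -
  have D: "bounded \<Omega>\<^sub>0" "\<Omega>\<^sub>0 \<noteq> {}" using assms(1) by (auto simp: C2_domain_def)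
  have compact: "compact \<Omega>" and ne: "\<Omega> \<noteq> {}"
    using D assms(2) by (auto simp: compact_closure)
  have closed: "closed \<Omega>" using assms(2) by simp
  have frontier_ne: "frontier \<Omega> \<noteq> {}"
    using compact ne by (metis compact_imp_bounded frontier_not_empty not_bounded_UNIV)
  \<comment> \<open>The metric uses the frontier of the closure, the tangent balls that of the open
    domain; this inclusion carries the ball condition over.\<close>
  have frontier_sub: "frontier \<Omega> \<subseteq> frontier \<Omega>\<^sub>0"
    unfolding assms(2) frontier_def closure_closure
    using interior_mono[OF closure_subset[of \<Omega>\<^sub>0]] by blast
  obtain r where r: "r > 0" and balls': "\<And>z. z \<in> frontier \<Omega>\<^sub>0 \<Longrightarrow>
    \<exists>v. norm v = 1 \<and> ball (z + r *\<^sub>R v) r \<inter> closure \<Omega>\<^sub>0 = {} \<and> ball (z - r *\<^sub>R v) r \<subseteq> \<Omega>\<^sub>0"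
    by (rule C2_domain_tangent_balls[OF assms(1)]) (rule that)
  have balls: "\<exists>v. norm v = 1 \<and> ball (z + r *\<^sub>R v) r \<inter> \<Omega> = {} \<and> ball (z - r *\<^sub>R v) r \<subseteq> \<Omega>"
    if z: "z \<in> frontier \<Omega>" for z
  proof -
    obtain v where "norm v = 1" "ball (z + r *\<^sub>R v) r \<inter> \<Omega> = {}" "ball (z - r *\<^sub>R v) r \<subseteq> \<Omega>\<^sub>0"
      using balls'[OF subsetD[OF frontier_sub z]] unfolding assms(2) by blast
    moreover have "\<Omega>\<^sub>0 \<subseteq> \<Omega>" unfolding assms(2) by (rule closure_subset)
    ultimately show ?thesis by blast
  qed
  obtain B' where B': "\<And>x. x \<in> \<Omega> \<Longrightarrow> norm x \<le> B'"
    using compact_imp_bounded[OF compact] unfolding bounded_iff by blast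
  define B where "B = max 1 B'"
  have B: "B \<ge> 1" "\<And>x. x \<in> \<Omega> \<Longrightarrow> norm x \<le> B"
    using B' unfolding B_def by (auto intro: order_trans[OF _ max.cobounded2])
  \<comment> \<open>The moments have exponent \<open>2 * K\<close>, which is at least
    \<open>l\<close>; the surplus is given up at the end since all weights are at least 1.\<close>
  define K where "K = nat \<lceil>l\<rceil>"
  have lK: "l \<le> real (2 * K)" using assms(3) unfolding K_def by linarith
  define C where "C = 4 / sqrt r"
  define R where "R = 2 * B + r"
  have C: "C > 0" and R: "R > 0" using r B by (auto simp: C_def R_def)
  define M where "M = ((2 + C * (2 * R + 4)) * B) ^ (2 * K) * real ((9 ^ K * Suc K) ^ Suc DIM((real ^ 'd) \<times> real))"
  have "0 < (2 + C * (2 * R + 4)) * B"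
    using C R B(1) by (intro mult_pos_pos add_pos_pos) auto
  then have M: "M > 0"
    unfolding M_def by (intro mult_pos_pos[OF zero_less_power]) (simp_all del: of_nat_mult of_nat_power)
  have quadric: "\<exists>w. (\<forall>x\<in>\<Omega>. r \<le> norm (x - w) \<and> norm (x - w) \<le> R) \<and>
    (\<forall>x\<in>\<Omega>. \<forall>\<eta>\<in>\<Omega>. \<bar>sqrt (infdist x (frontier \<Omega>)) - sqrt (infdist \<eta> (frontier \<Omega>))\<bar>
       \<le> C * (\<bar>sqrt ((norm (x - w))\<^sup>2 - r\<^sup>2) - sqrt ((norm (\<eta> - w))\<^sup>2 - r\<^sup>2)\<bar>
           + norm (x - y) + norm (\<eta> - y)))" if "y \<in> \<Omega>" for y
    unfolding C_def R_def
    by (rule sqrt_infdist_frontier_compare[OF closed frontier_ne r balls B(2) that])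
  \<comment> \<open>\<open>c\<^sub>0\<close> depends only on the dimension and \<open>l\<close>,
    whereas \<open>C\<^sub>1\<close> also involves the ball radius \<open>r\<close> and the norm
    bound \<open>B\<close> of \<Omega>. Both are fixed before \<open>n\<close>.\<close>
  define c\<^sub>0 where "c\<^sub>0 = (DIM((real ^ 'd) \<times> real) + 2) * Suc K"
  define C\<^sub>1 where "C\<^sub>1 = 2 ^ (2 * K) * M"
  have C1: "C\<^sub>1 > 0" using M by (simp add: C\<^sub>1_def)
  have "\<exists>(m :: nat) (\<xi> :: nat \<Rightarrow> (real ^ 'd) \<times> real) (P :: nat \<Rightarrow> (real ^ 'd) \<times> real \<Rightarrow> real).
         inj_on \<xi> {1..m} \<and> \<xi> ` {1..m} \<subseteq> \<Omega> \<and>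
         separated (rho \<Omega>) (1 / real n) (\<xi> ` {1..m}) \<and>
         (\<forall>j\<in>{1..m}. P j \<in> poly_space (c\<^sub>0 * n)) \<and>
         (\<forall>x\<in>\<Omega>. (\<Sum>j=1..m. P j x) = 1 \<and>
            (\<forall>j\<in>{1..m}. \<bar>P j x\<bar> \<le> C\<^sub>1 * (1 + real n * rho \<Omega> x (\<xi> j)) powr (- l)))"
    if n: "n \<ge> 1" for n
  proof -
    have "\<exists>(I :: (((real ^ 'd) \<times> real \<Rightarrow> nat) \<times> nat) set) \<eta> Q. finite I \<and> (\<forall>i\<in>I. \<eta> i \<in> \<Omega>) \<and>
        (\<forall>i\<in>I. Q i \<in> poly_space (c\<^sub>0 * n)) \<and>
        (\<forall>i\<in>I. \<forall>x\<in>\<Omega>. 0 \<le> Q i x) \<and>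
        (\<forall>x\<in>\<Omega>. (\<Sum>i\<in>I. Q i x) = 1 \<and>
          (\<Sum>i\<in>I. Q i x * (1 + real n * rho \<Omega> x (\<eta> i)) ^ (2 * K)) \<le> M)"
      unfolding M_def c\<^sub>0_def
      by (rule localized_partition_domain[OF compact ne n B(1) R less_imp_le[OF C] B(2) quadric less_imp_le[OF r]])
    then obtain I :: "(((real ^ 'd) \<times> real \<Rightarrow> nat) \<times> nat) set" and \<eta> Q where
      "finite I" "\<forall>i\<in>I. \<eta> i \<in> \<Omega>"
      "\<forall>i\<in>I. Q i \<in> poly_space (c\<^sub>0 * n)"
      "\<forall>i\<in>I. \<forall>x\<in>\<Omega>. 0 \<le> Q i x"
      "\<forall>x\<in>\<Omega>. (\<Sum>i\<in>I. Q i x) = 1 \<and>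
        (\<Sum>i\<in>I. Q i x * (1 + real n * rho \<Omega> x (\<eta> i)) ^ (2 * K)) \<le> M"
      by (elim exE conjE) (rule that)
    then have "\<exists>\<Lambda> P. finite \<Lambda> \<and> \<Lambda> \<subseteq> \<Omega> \<and> separated (rho \<Omega>) (1 / real n) \<Lambda> \<and>
      (\<forall>\<mu>\<in>\<Lambda>. P \<mu> \<in> poly_space (c\<^sub>0 * n)) \<and>
      (\<forall>x\<in>\<Omega>. (\<Sum>\<mu>\<in>\<Lambda>. P \<mu> x) = 1 \<and>
        (\<forall>\<mu>\<in>\<Lambda>. \<bar>P \<mu> x\<bar> * (1 + real n * rho \<Omega> x \<mu>) ^ (2 * K) \<le> C\<^sub>1))"
      unfolding C\<^sub>1_def
      by (intro regroup_partition[of I n \<eta> \<Omega> Q, OF _ n]) auto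
    then obtain \<Lambda> P where \<Lambda>: "finite \<Lambda>" "\<Lambda> \<subseteq> \<Omega>" "separated (rho \<Omega>) (1 / real n) \<Lambda>"
      and P_poly: "\<forall>\<mu>\<in>\<Lambda>. P \<mu> \<in> poly_space (c\<^sub>0 * n)"
      and P: "\<forall>x\<in>\<Omega>. (\<Sum>\<mu>\<in>\<Lambda>. P \<mu> x) = 1 \<and>
        (\<forall>\<mu>\<in>\<Lambda>. \<bar>P \<mu> x\<bar> * (1 + real n * rho \<Omega> x \<mu>) ^ (2 * K) \<le> C\<^sub>1)"
      by (elim exE conjE) (rule that)
    obtain \<xi> where \<xi>: "bij_betw \<xi> {1..card \<Lambda>} \<Lambda>"
      using ex_bij_betw_nat_finite_1[OF \<Lambda>(1)] by blast
    note image = bij_betw_imp_surj_on[OF \<xi>]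
    have decay: "\<bar>P \<mu> x\<bar> \<le> C\<^sub>1 * (1 + real n * rho \<Omega> x \<mu>) powr (- l)"
      if "x \<in> \<Omega>" "\<mu> \<in> \<Lambda>" for x \<mu>
    proof -
      define W where "W = 1 + real n * rho \<Omega> x \<mu>"
      have W: "W \<ge> 1" by (simp add: W_def rho_nonneg)
      have "\<bar>P \<mu> x\<bar> * W ^ (2 * K) \<le> C\<^sub>1" using P that unfolding W_def by blast
      then have "\<bar>P \<mu> x\<bar> \<le> C\<^sub>1 * (1 / W ^ (2 * K))"
        using W by (simp add: field_simps)
      also have "1 / W ^ (2 * K) = W powr (- real (2 * K))"
        using W by (subst powr_minus, subst powr_realpow) (auto simp: divide_inverse)
      also have "C\<^sub>1 * W powr (- real (2 * K)) \<le> C\<^sub>1 * W powr (- l)"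
        using W lK C1 by (intro mult_left_mono powr_mono) auto
      finally show ?thesis unfolding W_def .
    qed
    show ?thesis
    proof (intro exI[of _ "card \<Lambda>"] exI[of _ \<xi>] exI[of _ "P \<circ> \<xi>"] conjI)
      show "inj_on \<xi> {1..card \<Lambda>}" using \<xi> by (rule bij_betw_imp_inj_on)
      show "\<xi> ` {1..card \<Lambda>} \<subseteq> \<Omega>" unfolding image by fact
      show "separated (rho \<Omega>) (1 / real n) (\<xi> ` {1..card \<Lambda>})" unfolding image by fact
      show "\<forall>j\<in>{1..card \<Lambda>}. (P \<circ> \<xi>) j \<in> poly_space (c\<^sub>0 * n)"
        using P_poly image by auto
      show "\<forall>x\<in>\<Omega>. (\<Sum>j=1..card \<Lambda>. (P \<circ> \<xi>) j x) = 1 \<and> (\<forall>j\<in>{1..card \<Lambda>}. \<bar>(P \<circ> \<xi>) j x\<bar>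
          \<le> C\<^sub>1 * (1 + real n * rho \<Omega> x (\<xi> j)) powr (- l))"
      proof (intro ballI conjI)
        fix x assume x: "x \<in> \<Omega>"
        show "(\<Sum>j=1..card \<Lambda>. (P \<circ> \<xi>) j x) = 1"
          using sum.reindex_bij_betw[OF \<xi>, of "\<lambda>\<mu>. P \<mu> x"] P x by simp
        fix j assume "j \<in> {1..card \<Lambda>}"
        then have "\<xi> j \<in> \<Lambda>" using image by blast
        from decay[OF x this]
        show "\<bar>(P \<circ> \<xi>) j x\<bar> \<le> C\<^sub>1 * (1 + real n * rho \<Omega> x (\<xi> j)) powr (- l)" by simp
      qed
    qed
  qed
  moreover have "c\<^sub>0 > 0" by (simp add: c\<^sub>0_def)
  ultimately show ?thesis using C1 by blast
qed

end
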